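(* Let $y\in\mathbb{R}^M$, let $\Phi$ be a real $M\times N$ matrix with unit-norm columns, let $\lambda,\tau>0$, and let $T_\lambda$ be a thresholding activation function satisfying the conditions listed in the context. Consider the LCA network $$\tau\dot u(t) = -u(t)-(\Phi^T\Phi-I)\,a(t)+\Phi^T y,\qquad a(t)=T_\lambda(u(t)).$$ Provided that the constants $\alpha$ and $\delta$ defined in the context satisfy $$\alpha\delta<1,$$ the LCA network is globally exponentially convergent to a unique equilibrium with convergence speed $$c=\frac{1-\alpha\delta}{\tau}.$$
   Context: Activation function: $T_\lambda:\mathbb{R}\to\mathbb{R}$ is given by $T_\lambda(v)=0$ if $|v|\le\lambda$ and $T_\lambda(v)=f(v)$ if $|v|>\lambda$, and is applied to vectors componentwise. Here $f$ is real-valued and continuous on $\mathcal{D}=(-\infty,-\lambda]\cup[\lambda,+\infty)$, differentiable on the interior of $\mathcal{D}$, and satisfies: (a) $f(-v)=-f(v)$ for all $v\in\mathcal{D}$ and $f(\lambda)=0$; (b) $f'(v)>0$ on $\mathcal{D}$ (wherever the derivative is defined, i.e. on the interior); (c) $f(v)\le v$ for all $v\in\mathcal{D}$ with $v\ge 0$. An equilibrium (fixed point) is a constant vector $u^*\in\mathbb{R}^N$ with $-u^*-(\Phi^T\Phi-I)T_\lambda(u^* )+\Phi^Ty=0$. Exponential convergence: the system is exponentially convergent to $u^*$ with convergence speed $c>0$ if for any initial point $u(0)$ there exists a constant $\kappa_0>0$ (which may depend on $u(0)$) for which the trajectory $u(t)$ satisfies $\|u(t)-u^*\|\le\kappa_0e^{-ct}$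 for all $t\ge0$. Active sets: the active set at time $t$ is $\Gamma=\{n\in\{1,\dots,N\}:|u_n(t)|>\lambda\}$, i.e. the set of indices of nonzero outputs; the active set of a vector $x$ of outputs is the set of indices of its nonzero entries. Constant $\alpha$: a bound on the derivative of $f$ along the trajectory $u(t)$ of the network, $$|f'(u_n(t))|\le\alpha\qquad\text{for all } t\ge0 \text{ and all } n=1,\dots,N \text{ (with } |u_n(t)|>\lambda).$$ (The paper observes that $\alpha$ is always well defined since the trajectories $u_n(t)$ are bounded and $f$ is continuous.) Constant $\delta$: the smallest positive constant such that for any active set $\Gamma$ visited by the network and any vector $x\in\mathbb{R}^N$ with active set $\widetilde\Gamma=\Gamma\cup\Gamma_*$, $$(1-\delta)\|x\|_2^2\le\|\Phi x\|_2^2\le(1+\delta)\|x\|_2^2 .$$ Thus $\delta$ depends on the singular values of the submatrices of $\Phi$ with columns indexed by $\widetilde\Gamma$ and on the sequence of active sets visited by the system. Here $\Gamma_*$ is the active set of the solution of $\min_a \tfrac12\|y-\Phi a\|_2^2+\lambda\sum_{n=1}^N C(a_n)$, where $C$ is the cost function associated with $T_\lambda$: continuous on the range of $T_\lambda$, $C(0)=0$, and for $a\ne0$ in that range $\lambda C'(a)=v-a$, where $v\in\mathcal{D}$ is the unique point with $f(v)=a$. *)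

theory Defs
  imports "HOL-Analysis.Analysis"
begin

definition act_dom :: "real \<Rightarrow> real set" where
  "act_dom lam = {..-lam} \<union> {lam..}"

text \<open>Only the values of \<open>f\<close> on \<^term>\<open>act_dom lam\<close> are constrained, and only these
  are ever used: \<open>deriv f v\<close> below is always taken at interior points.\<close>

definition activation :: "real \<Rightarrow> (real \<Rightarrow> real) \<Rightarrow> bool" where
  "activation lam f \<longleftrightarrow>
     continuous_on (act_dom lam) f \<and>
     f differentiable_on interior (act_dom lam) \<and>
     (\<forall>v\<in>act_dom lam. f (- v) = - f v) \<and> f lam = 0 \<and>
     (\<forall>v\<in>interior (act_dom lam). 0 < deriv f v) \<and>
     (\<forall>v\<in>act_dom lam. 0 \<le> v \<longrightarrow> f v \<le> v)"

definition thr :: "real \<Rightarrow> (real \<Rightarrow> real) \<Rightarrow> real \<Rightarrow> real" where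
  "thr lam f v = (if \<bar>v\<bar> \<le> lam then 0 else f v)"

definition thr_vec :: "real \<Rightarrow> (real \<Rightarrow> real) \<Rightarrow> real^'n \<Rightarrow> real^'n" where
  "thr_vec lam f x = (\<chi> i. thr lam f (x $ i))"

definition lca_field ::
  "real \<Rightarrow> (real \<Rightarrow> real) \<Rightarrow> real^'n^'m \<Rightarrow> real^'m \<Rightarrow> real^'n \<Rightarrow> real^'n" where
  "lca_field lam f \<Phi> y x =
     - x - (transpose \<Phi> ** \<Phi> - mat 1) *v thr_vec lam f x + transpose \<Phi> *v y"

text \<open>The derivative at time 0 is one-sided; values of \<open>u\<close> at negative times are irrelevant.\<close>

definition lca_trajectory ::
  "real \<Rightarrow> real \<Rightarrow> (real \<Rightarrow> real) \<Rightarrow> real^'n^'m \<Rightarrow> real^'m \<Rightarrow> (real \<Rightarrow> real^'n) \<Rightarrow> bool" where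
  "lca_trajectory tau lam f \<Phi> y u \<longleftrightarrow>
     (\<forall>t\<ge>0. (u has_vector_derivative (1 / tau) *\<^sub>R lca_field lam f \<Phi> y (u t)) (at t within {0..}))"

definition lca_equilibrium ::
  "real \<Rightarrow> (real \<Rightarrow> real) \<Rightarrow> real^'n^'m \<Rightarrow> real^'m \<Rightarrow> real^'n \<Rightarrow> bool" where
  "lca_equilibrium lam f \<Phi> y x \<longleftrightarrow> lca_field lam f \<Phi> y x = 0"

definition active_nodes :: "real \<Rightarrow> real^'n \<Rightarrow> 'n set" where
  "active_nodes lam x = {n. lam < \<bar>x $ n\<bar>}"

definition active_set :: "real^'n \<Rightarrow> 'n set" where
  "active_set a = {n. a $ n \<noteq> 0}"

definition cost_function :: "real \<Rightarrow> (real \<Rightarrow> real) \<Rightarrow> (real \<Rightarrow> real) \<Rightarrow> bool" where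
  "cost_function lam f C \<longleftrightarrow>
     continuous_on (range (thr lam f)) C \<and> C 0 = 0 \<and>
     (\<forall>a \<in> range (thr lam f) - {0}. \<forall>v\<in>act_dom lam. f v = a \<longrightarrow>
        (\<exists>C'. (C has_real_derivative C') (at a within range (thr lam f)) \<and> lam * C' = v - a))"

definition objective ::
  "real \<Rightarrow> (real \<Rightarrow> real) \<Rightarrow> real^'n^'m \<Rightarrow> real^'m \<Rightarrow> real^'n \<Rightarrow> real" where
  "objective lam C \<Phi> y a = 1/2 * (norm (y - \<Phi> *v a))\<^sup>2 + lam * (\<Sum>n\<in>UNIV. C (a $ n))"

text \<open>The cost is only meaningful on the range of the activation function, so the minimum is
  over vectors whose entries lie in that range.\<close>

definition objective_minimizer ::
  "real \<Rightarrow> (real \<Rightarrow> real) \<Rightarrow> (real \<Rightarrow> real) \<Rightarrow> real^'n^'m \<Rightarrow> real^'m \<Rightarrow> real^'n \<Rightarrow> bool" where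
  "objective_minimizer lam f C \<Phi> y a \<longleftrightarrow>
     (\<forall>n. a $ n \<in> range (thr lam f)) \<and>
     (\<forall>b. (\<forall>n. b $ n \<in> range (thr lam f)) \<longrightarrow>
        objective lam C \<Phi> y a \<le> objective lam C \<Phi> y b)"

text \<open>The conjunct \<open>0 \<le> \<alpha>\<close> only matters for a trajectory none of whose nodes is ever active.\<close>

definition alpha_constant :: "real \<Rightarrow> (real \<Rightarrow> real) \<Rightarrow> (real \<Rightarrow> real^'n) \<Rightarrow> real \<Rightarrow> bool" where
  "alpha_constant lam f u \<alpha> \<longleftrightarrow>
     0 \<le> \<alpha> \<and> (\<forall>t\<ge>0. \<forall>n. lam < \<bar>u t $ n\<bar> \<longrightarrow> \<bar>deriv f (u t $ n)\<bar> \<le> \<alpha>)"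

definition isometry_bound ::
  "real \<Rightarrow> real^'n^'m \<Rightarrow> 'n set \<Rightarrow> (real \<Rightarrow> real^'n) \<Rightarrow> real \<Rightarrow> bool" where
  "isometry_bound lam \<Phi> Gs u \<delta> \<longleftrightarrow>
     (\<forall>t\<ge>0. \<forall>x. active_set x = active_nodes lam (u t) \<union> Gs \<longrightarrow>
        (1 - \<delta>) * (norm x)\<^sup>2 \<le> (norm (\<Phi> *v x))\<^sup>2 \<and>
        (norm (\<Phi> *v x))\<^sup>2 \<le> (1 + \<delta>) * (norm x)\<^sup>2)"

text \<open>The smallest positive constant. It fails to exist exactly when every positive constant
  works (all the column submatrices involved have orthonormal columns); then any positive
  constant is accepted. The value 0 is not: an inactive node driven by active ones
  decaying like \<open>exp (- t / tau)\<close> can decay only like \<open>t * exp (- t / tau)\<close>.\<close>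

definition delta_constant ::
  "real \<Rightarrow> real^'n^'m \<Rightarrow> 'n set \<Rightarrow> (real \<Rightarrow> real^'n) \<Rightarrow> real \<Rightarrow> bool" where
  "delta_constant lam \<Phi> Gs u \<delta> \<longleftrightarrow>
     0 < \<delta> \<and> isometry_bound lam \<Phi> Gs u \<delta> \<and>
     ((\<forall>d>0. isometry_bound lam \<Phi> Gs u d) \<or>
      (\<forall>d>0. isometry_bound lam \<Phi> Gs u d \<longrightarrow> \<delta> \<le> d))"

text \<open>The speed \<open>c\<close> is a function of the trajectory, because it is built from constants
  attached to a trajectory; a single speed for the whole network is the case of constant \<open>c\<close>.\<close>

definition globally_exp_convergent ::
  "((real \<Rightarrow> real^'n) \<Rightarrow> bool) \<Rightarrow> real^'n \<Rightarrow> ((real \<Rightarrow> real^'n) \<Rightarrow> real) \<Rightarrow> bool" where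
  "globally_exp_convergent Traj x c \<longleftrightarrow>
     (\<forall>u. Traj u \<longrightarrow> 0 < c u \<and>
        (\<exists>\<kappa>>0. \<forall>t\<ge>0. norm (u t - x) \<le> \<kappa> * exp (- c u * t)))"

end

theory Submission
  imports Defs
begin

text \<open>
  Write \<open>G = \<Phi>\<^sup>T \<Phi> - I\<close>. The first-order conditions at the minimizer \<open>a\<^sub>*\<close> say that
  \<open>u\<^sub>* = a\<^sub>* + \<Phi>\<^sup>T (y - \<Phi> a\<^sub>*)\<close> has output \<open>a\<^sub>*\<close>, so \<open>u\<^sub>*\<close> is an equilibrium.

  Peano's theorem gives trajectories from every point. Those starting with all nodes active at a
  common value \<open>v\<close> turn the hypothesis \<open>\<alpha> \<delta> < 1\<close> into \<open>D f'(v) < 1\<close>, where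
  \<open>D\<close> is the norm of the quadratic form of \<open>G\<close>. Hence \<open>D T\<close> strictly decreases distances,
  \<open>\<bar>u - u\<^sub>*\<bar>\<^sup>2\<close> is a strict Lyapunov function, and every trajectory converges to \<open>u\<^sub>*\<close>.

  For the rate, let \<open>w\<close> be the error on the coordinates active at \<open>u\<^sub>*\<close> and the soft
  threshold of \<open>u\<close> on the others. Then \<open>w\<close> and the output error \<open>a - a\<^sub>*\<close> are supported on
  the set for which \<open>\<delta>\<close> is an isometry constant, and \<open>\<bar>a - a\<^sub>*\<bar> \<le> \<alpha> \<bar>w\<bar>\<close>, so
  \<open>\<bar>w\<bar>\<^sup>2\<close> decays at rate \<open>2 c\<close>. The full error solves a linear equation driven by
  \<open>G (a - a\<^sub>*)\<close> and inherits the rate \<open>c\<close>.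
\<close>

subsection \<open>The activation function and its cost\<close>

context
  fixes lam :: real and f :: "real \<Rightarrow> real"
  assumes lam: "lam > 0" and act: "activation lam f"
begin

lemma interior_act_dom: "interior (act_dom lam) = {..<-lam} \<union> {lam<..}"
proof
  show "{..<-lam} \<union> {lam<..} \<subseteq> interior (act_dom lam)"
    by (rule interior_maximal) (auto simp: act_dom_def)
  show "interior (act_dom lam) \<subseteq> {..<-lam} \<union> {lam<..}"
  proof
    fix x assume x: "x \<in> interior (act_dom lam)"
    then obtain e where e: "e > 0" "ball x e \<subseteq> act_dom lam"
      by (auto simp: mem_interior)
    \<comment> \<open>Capping \<open>d\<close> at \<open>lam\<close> keeps \<open>x - d\<close> and
      \<open>x + d\<close> from leaping across the gap between the two branches, so a boundary point
      \<open>x\<close> would have one of them inside the gap.\<close>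
    define d where "d = min (e/2) lam"
    have d: "0 < d" "d \<le> lam" "d < e" using e lam by (auto simp: d_def min_def)
    have "x \<in> act_dom lam" "x - d \<in> act_dom lam" "x + d \<in> act_dom lam"
      using d e by (auto simp: subset_iff dist_real_def)
    then show "x \<in> {..<-lam} \<union> {lam<..}"
      using d lam by (auto simp: act_dom_def)
  qed
qed

lemma act_odd: "lam \<le> v \<Longrightarrow> f (- v) = - f v"
  and act_zero: "f lam = 0"
  and act_le: "lam \<le> v \<Longrightarrow> f v \<le> v"
  using act lam by (auto simp: activation_def act_dom_def)

lemma act_continuous: "continuous_on {lam..} f"
  using act by (auto simp: activation_def act_dom_def intro: continuous_on_subset)

lemma act_has_deriv: "lam < v \<Longrightarrow> (f has_real_derivative deriv f v) (at v)"
  and act_deriv_pos: "lam < v \<Longrightarrow> 0 < deriv f v"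
proof -
  assume v: "lam < v"
  have "open (interior (act_dom lam))" by simp
  moreover have "v \<in> interior (act_dom lam)" using v by (simp add: interior_act_dom)
  moreover have "f differentiable_on interior (act_dom lam)"
    using act by (simp add: activation_def)
  ultimately have "f differentiable at v"
    using differentiable_on_eq_differentiable_at by blast
  then show "(f has_real_derivative deriv f v) (at v)"
    using DERIV_deriv_iff_real_differentiable by blast
next
  assume "lam < v" then show "0 < deriv f v"
    using act by (auto simp: activation_def interior_act_dom)
qed

lemma act_mvt:
  assumes "lam \<le> p" "p < q"
  obtains \<xi> where "p < \<xi>" "\<xi> < q" "f q - f p = deriv f \<xi> * (q - p)"
proof (rule mvt[OF assms(2), of f "\<lambda>x y. deriv f x * y"])
  show "continuous_on {p..q} f"
    using act_continuous assms(1) by (auto intro: continuous_on_subset)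
  show "(f has_derivative (*) (deriv f x)) (at x)" if "p < x" "x < q" for x
    using act_has_deriv[of x] that assms(1) by (simp add: has_field_derivative_def)
qed (use that in blast)

lemma act_strict_mono: "lam \<le> p \<Longrightarrow> p < q \<Longrightarrow> f p < f q"
  using act_mvt[of p q] act_deriv_pos
  by (metis diff_gt_0_iff_gt mult_pos_pos order_le_less_trans)

lemma act_nonneg: "lam \<le> v \<Longrightarrow> 0 \<le> f v"
  using act_strict_mono[of lam v] act_zero by (cases "lam = v") auto

section \<open>Elementary properties of the thresholded activation\<close>

lemma thr_odd: "thr lam f (- v) = - thr lam f v"
  using act_odd[of v] act_odd[of "-v"] by (cases "0 \<le> v") (auto simp: thr_def)

text \<open>Clamping at \<open>lam\<close> replaces the case distinction by two evaluations of
  \<open>f\<close> on the half-line \<open>{lam..}\<close>, one per branch; since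
  \<open>f lam = 0\<close>, an idle branch contributes nothing. Continuity, monotonicity and all
  difference bounds reduce to that half-line.\<close>

lemma thr_clamp: "thr lam f v = f (max lam v) - f (max lam (- v))"
  using act_odd[of "-v"] act_zero lam by (auto simp: thr_def max_def)

lemma continuous_thr: "continuous_on UNIV (thr lam f)"
proof -
  have "continuous_on UNIV (\<lambda>v. f (max lam v) - f (max lam (- v)))"
    by (intro continuous_intros continuous_on_compose2[OF act_continuous]) auto
  then show ?thesis by (simp add: thr_clamp[abs_def])
qed

lemma abs_thr_le: "\<bar>thr lam f v\<bar> \<le> \<bar>v\<bar>"
  using act_nonneg[of "\<bar>v\<bar>"] act_le[of "\<bar>v\<bar>"] act_odd[of "-v"] by (auto simp: thr_def abs_if)

lemma thr_eq_0_iff: "thr lam f v = 0 \<longleftrightarrow> \<bar>v\<bar> \<le> lam"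
  using act_strict_mono[of lam v] act_strict_mono[of lam "-v"] act_zero act_odd[of "-v"]
  by (auto simp: thr_def abs_if)

lemma thr_mono: "p \<le> q \<Longrightarrow> thr lam f p \<le> thr lam f q"
proof -
  assume "p \<le> q"
  then have "max lam p \<le> max lam q" "max lam (-q) \<le> max lam (-p)" by auto
  moreover have "f a \<le> f b" if "lam \<le> a" "a \<le> b" for a b
    using act_strict_mono[of a b] that by (cases "a = b") auto
  ultimately show ?thesis unfolding thr_clamp by (smt (verit) max.cobounded1)
qed

lemma deriv_act_even: "lam < v \<Longrightarrow> deriv f (- v) = deriv f v"
proof -
  assume v: "lam < v"
  have *: "((\<lambda>x. - f (- x)) has_real_derivative deriv f v) (at (- v))"
    using act_has_deriv[OF v]
    by (auto intro!: derivative_eq_intros DERIV_chain2[where g = "\<lambda>x. - x"])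
  have "(f has_real_derivative deriv f v) (at (- v))"
  proof (rule has_field_derivative_transform_within_open[OF *])
    show "- f (- x) = f x" if "x \<in> {..<-lam}" for x
      using act_odd[of "-x"] that by simp
  qed (use v in auto)
  then show ?thesis by (rule DERIV_imp_deriv)
qed

section \<open>Lipschitz and contraction estimates\<close>

text \<open>The mean value theorem applies separately to the parts of the segment above
  \<open>lam\<close> and below \<open>-lam\<close>, the lower part being reflected by evenness of
  the derivative. The dead zone contributes nothing, so the two clamped lengths add up to at most
  \<open>q - p\<close>.\<close>

lemma thr_lipschitz_le:
  assumes "p \<le> q" "0 \<le> L"
    and L: "\<And>w. p < w \<Longrightarrow> w < q \<Longrightarrow> lam < \<bar>w\<bar> \<Longrightarrow> deriv f w \<le> L"
  shows "thr lam f q - thr lam f p \<le> L * (q - p)"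
proof -
  have 1: "f b - f a \<le> L * (b - a)"
    if "lam \<le> a" "a \<le> b" "\<And>w. a < w \<Longrightarrow> w < b \<Longrightarrow> deriv f w \<le> L" for a b
  proof (cases "a = b")
    case False
    then have "a < b" using that by simp
    from act_mvt[OF that(1) this] obtain \<xi> where "a < \<xi>" "\<xi> < b" "f b - f a = deriv f \<xi> * (b - a)"
      by metis
    then show ?thesis using that mult_right_mono[of "deriv f \<xi>" L "b - a"] by auto
  qed simp
  have "f (max lam q) - f (max lam p) \<le> L * (max lam q - max lam p)"
    by (rule 1) (use assms lam in \<open>auto simp: max_def split: if_splits\<close>)
  moreover have "f (max lam (-p)) - f (max lam (-q)) \<le> L * (max lam (-p) - max lam (-q))"
  proof (rule 1)
    fix w assume w: "max lam (- q) < w" "w < max lam (- p)"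
    then have "deriv f (- w) \<le> L" by (intro L) (use lam in \<open>auto simp: max_def split: if_splits\<close>)
    then show "deriv f w \<le> L" using deriv_act_even[of w] w by auto
  qed (use assms in auto)
  moreover have "max lam q - max lam p + (max lam (-p) - max lam (-q)) \<le> q - p"
    using \<open>p \<le> q\<close> lam by (auto simp: max_def)
  then have "L * (max lam q - max lam p + (max lam (-p) - max lam (-q))) \<le> L * (q - p)"
    using \<open>0 \<le> L\<close> by (rule mult_left_mono)
  ultimately show ?thesis unfolding thr_clamp by (simp add: algebra_simps)
qed

lemma abs_thr_diff_le:
  assumes "0 \<le> L"
    and L: "\<And>w. min p q < w \<Longrightarrow> w < max p q \<Longrightarrow> lam < \<bar>w\<bar> \<Longrightarrow> deriv f w \<le> L"
  shows "\<bar>thr lam f q - thr lam f p\<bar> \<le> L * \<bar>q - p\<bar>"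
proof (cases "p \<le> q")
  case True
  then show ?thesis using thr_lipschitz_le[of p q L] thr_mono[of p q] assms by auto
next
  case False
  then show ?thesis using thr_lipschitz_le[of q p L] thr_mono[of q p] assms
    by (auto simp: abs_if min_def max_def)
qed

text \<open>The supremum of \<open>D * deriv f w\<close> may equal 1, so no uniform factor below 1
  is available; strictness comes from the mean value theorem at a single point. One of the two
  clamped segments is nondegenerate unless \<open>p\<close> and \<open>q\<close> both lie in the
  dead zone, where the left side vanishes.\<close>

lemma thr_strict_contraction_less:
  assumes "p < q" "0 \<le> D" and D: "\<And>w. lam < w \<Longrightarrow> D * deriv f w < 1"
  shows "D * (thr lam f q - thr lam f p) < q - p"
proof -
  have strict: "D * (f b - f a) < b - a" if "lam \<le> a" "a < b" for a b
  proof -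
    from act_mvt[OF that] obtain \<xi> where "a < \<xi>" "\<xi> < b" "f b - f a = deriv f \<xi> * (b - a)"
      by metis
    then show ?thesis using that mult_strict_right_mono[OF D[of \<xi>], of "b - a"] by (simp add: mult.assoc)
  qed
  have weak: "D * (f b - f a) \<le> b - a" if "lam \<le> a" "a \<le> b" for a b
    using strict[of a b] that by (cases "a = b") auto
  consider "q \<le> lam" "-lam \<le> p" | "lam < q" | "p < -lam" by linarith
  then show ?thesis
  proof cases
    case 1
    then show ?thesis using assms by (simp add: thr_def abs_if)
  next
    case 2
    have "D * (f (max lam q) - f (max lam p)) < max lam q - max lam p"
      by (rule strict) (use assms 2 in auto)
    moreover have "D * (f (max lam (-p)) - f (max lam (-q))) \<le> max lam (-p) - max lam (-q)"
      by (rule weak) (use assms in auto)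
    ultimately show ?thesis unfolding thr_clamp using \<open>p < q\<close> lam
      by (simp add: algebra_simps max_def split: if_splits)
  next
    case 3
    have "D * (f (max lam q) - f (max lam p)) \<le> max lam q - max lam p"
      by (rule weak) (use assms 3 in auto)
    moreover have "D * (f (max lam (-p)) - f (max lam (-q))) < max lam (-p) - max lam (-q)"
      by (rule strict) (use assms 3 in auto)
    ultimately show ?thesis unfolding thr_clamp using \<open>p < q\<close> lam
      by (simp add: algebra_simps max_def split: if_splits)
  qed
qed

lemma thr_strict_contraction:
  assumes "p \<noteq> q" "0 \<le> D" and D: "\<And>w. lam < w \<Longrightarrow> D * deriv f w < 1"
  shows "\<bar>D * (thr lam f q - thr lam f p)\<bar> < \<bar>q - p\<bar>"
proof -
  have *: "\<bar>D * (thr lam f b - thr lam f a)\<bar> < b - a" if "a < b" for a b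
    using thr_strict_contraction_less[OF that assms(2) D] thr_mono[of a b] that \<open>0 \<le> D\<close>
    by (auto simp: abs_of_nonneg)
  show ?thesis
  proof (cases "p < q")
    case False
    then show ?thesis using *[of q p] assms(1)
      by (simp add: abs_mult abs_minus_commute)
  qed (use * in auto)
qed


section \<open>The cost function on the range of the activation\<close>

lemma interval_subset_range_thr: "lam \<le> v \<Longrightarrow> {- f v..f v} \<subseteq> range (thr lam f)"
proof
  fix b assume v: "lam \<le> v" and b: "b \<in> {- f v..f v}"
  have "thr lam f v = f v" using v act_zero lam by (auto simp: thr_def)
  then have "\<exists>x\<ge>-v. x \<le> v \<and> thr lam f x = b"
    using b v lam thr_odd[of v] by (intro IVT') (auto intro: continuous_on_subset[OF continuous_thr])
  then show "b \<in> range (thr lam f)" by blast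
qed

text \<open>The cost is differentiated relative to the range only. The range contains an open
  interval around \<open>b\<close>, so that derivative is an ordinary two-sided one.\<close>

lemma at_within_range_thr:
  assumes "lam < v" "\<bar>b\<bar> < f v"
  shows "at b within range (thr lam f) = at b"
proof (rule at_within_interior)
  have "{- f v<..<f v} \<subseteq> range (thr lam f)"
    using interval_subset_range_thr[of v] assms by (auto simp: subset_iff)
  then have "{- f v<..<f v} \<subseteq> interior (range (thr lam f))" by (rule interior_maximal) simp
  then show "b \<in> interior (range (thr lam f))"
    using assms(2) by (intro subsetD[of "{- f v<..<f v}" "interior (range (thr lam f))"]) auto
qed

lemma range_thr_preimage:
  assumes "b \<in> range (thr lam f)" "b \<noteq> 0"
  obtains v where "lam < \<bar>v\<bar>" "f v = b" "thr lam f v = b" "v \<in> act_dom lam"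
proof -
  from assms obtain v where "thr lam f v = b" "\<not> \<bar>v\<bar> \<le> lam"
    using thr_eq_0_iff by blast
  then show thesis by (intro that[of v]) (auto simp: thr_def act_dom_def abs_if split: if_splits)
qed

lemma cost_function_deriv:
  assumes "cost_function lam f C" "lam < \<bar>v\<bar>" "lam < w" "\<bar>f v\<bar> < f w"
  obtains C' where "(C has_real_derivative C') (at (f v))" "lam * C' = v - f v"
proof -
  have "f v \<in> range (thr lam f) - {0}"
    using assms(2) thr_eq_0_iff[of v] by (auto simp: thr_def image_iff split: if_splits intro: exI[of _ v])
  moreover have "v \<in> act_dom lam" using assms(2) by (auto simp: act_dom_def)
  ultimately show thesis
    using assms(1) at_within_range_thr[OF assms(3,4)] that unfolding cost_function_def by metis
qed

text \<open>Along either ray from 0 the slope of \<open>lam * C\<close> is input minus output in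
  absolute value, hence at most \<open>v\<close> up to the output \<open>f v\<close>. The mean value
  theorem asks only for continuity at 0, where \<open>C\<close> may have a kink. The sign
  \<open>s\<close> selects the ray.\<close>

lemma cost_function_upper_slope:
  assumes cost: "cost_function lam f C" and v: "lam < v" and s: "s = 1 \<or> s = -1"
  shows "lam * C (s * f v) \<le> f v * v"
proof -
  have pos: "0 < f v" using act_strict_mono[of lam v] act_zero v by simp
  have deriv: "\<exists>d. ((\<lambda>x. C (s * x)) has_real_derivative d) (at x) \<and> lam * d \<le> v"
    if x: "0 < x" "x < f v" for x
  proof -
    have "s * x \<in> range (thr lam f)" "s * x \<noteq> 0"
      using interval_subset_range_thr[of v] v x s by auto
    then obtain w where w: "lam < \<bar>w\<bar>" "f w = s * x" using range_thr_preimage by metis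
    have xw: "\<bar>f w\<bar> < f v" using w x s by auto
    \<comment> \<open>An input beyond \<open>v\<close> would produce an output of modulus larger
      than \<open>f v\<close>.\<close>
    have "s * w \<le> v"
    proof (rule ccontr)
      assume "\<not> s * w \<le> v"
      then have "f v < f (s * w)" using v by (intro act_strict_mono) auto
      moreover have "\<bar>f (s * w)\<bar> = \<bar>f w\<bar>"
        using s act_odd[of w] act_odd[of "-w"] w(1) by (cases "0 \<le> w") auto
      ultimately show False using xw by linarith
    qed
    obtain C' where C': "(C has_real_derivative C') (at (f w))" "lam * C' = w - f w"
      using cost_function_deriv[OF cost w(1) v xw] by metis
    have "((\<lambda>x. C (s * x)) has_real_derivative C' * s) (at x)"
      using C'(1) w(2) by (auto intro!: DERIV_chain2[where g = "(*) s"] derivative_eq_intros)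
    moreover have "lam * (C' * s) = s * w - x"
      using C'(2) w(2) s by (auto simp: mult.assoc[symmetric])
    ultimately show ?thesis using \<open>s * w \<le> v\<close> x by (intro exI[of _ "C' * s"]) auto
  qed
  have "continuous_on {0..f v} (\<lambda>x. C (s * x))"
  proof (rule continuous_on_compose2[of "range (thr lam f)" C "{0..f v}" "(*) s"])
    show "continuous_on (range (thr lam f)) C" using cost by (simp add: cost_function_def)
    show "(*) s ` {0..f v} \<subseteq> range (thr lam f)"
      by (rule order_trans[OF _ interval_subset_range_thr[of v]]) (use v s in auto)
  qed (intro continuous_intros)
  moreover have "(\<lambda>x. C (s * x)) differentiable at x" if "0 < x" "x < f v" for x
    using deriv[OF that] real_differentiable_def by blast
  ultimately obtain d z where z: "0 < z" "z < f v" "((\<lambda>x. C (s * x)) has_real_derivative d) (at z)"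
    "C (s * f v) - C (s * 0) = (f v - 0) * d"
    using MVT[OF pos, of "\<lambda>x. C (s * x)"] by blast
  have "lam * d \<le> v" using deriv[OF z(1,2)] z(3) DERIV_unique by blast
  then have "f v * (lam * d) \<le> f v * v" using pos by (intro mult_left_mono) auto
  moreover have "C (s * f v) = f v * d" using z(4) cost by (simp add: cost_function_def)
  ultimately show ?thesis by (simp add: mult.left_commute)
qed

text \<open>Here \<open>\<gamma>\<close> stands for the correlation of the residual with one column,
  and \<open>min\<close> for optimality under changes of that coordinate alone. A nonzero
  \<open>a\<close> is interior to the range, so stationarity gives \<open>\<gamma> = v - a\<close>.
  At 0, a possible kink of the cost, the slope bound along both rays gives
  \<open>\<bar>\<gamma>\<bar> \<le> lam\<close>.\<close>

lemma scalar_minimizer_thr: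
  assumes cost: "cost_function lam f C" and a: "a \<in> range (thr lam f)"
    and min: "\<And>b. b \<in> range (thr lam f) \<Longrightarrow> (b - a) * \<gamma> - (b - a)\<^sup>2 / 2 \<le> lam * (C b - C a)"
  shows "thr lam f (a + \<gamma>) = a"
proof (cases "a = 0")
  case True
  have bound: "s * \<gamma> \<le> v + f v / 2" if s: "s = 1 \<or> s = -1" and v: "lam < v" for s v
  proof -
    have pos: "0 < f v" using act_strict_mono[of lam v] act_zero v by simp
    have "s * f v \<in> range (thr lam f)" using interval_subset_range_thr[of v] v s pos by auto
    from min[OF this] have "f v * (s * \<gamma>) - (f v)\<^sup>2 / 2 \<le> lam * C (s * f v)"
      using True cost s by (auto simp: cost_function_def)
    also have "\<dots> \<le> f v * v" by (rule cost_function_upper_slope[OF cost v s])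
    finally have "f v * (s * \<gamma>) \<le> f v * (v + f v / 2)"
      by (simp add: algebra_simps power2_eq_square)
    then show ?thesis using pos by simp
  qed
  \<comment> \<open>As \<open>v\<close> decreases to \<open>lam\<close>, \<open>f v\<close> tends to
    0 and the bound tends to the threshold itself.\<close>
  have "s * \<gamma> \<le> lam" if s: "s = 1 \<or> s = -1" for s
  proof (rule tendsto_lowerbound)
    have "continuous_on {lam..} (\<lambda>v. v + f v / 2)"
      by (intro continuous_intros act_continuous) auto
    then have "((\<lambda>v. v + f v / 2) \<longlongrightarrow> lam + f lam / 2) (at lam within {lam..})"
      by (simp add: continuous_on_def)
    then show "((\<lambda>v. v + f v / 2) \<longlongrightarrow> lam) (at_right lam)"
      unfolding act_zero by (auto intro: tendsto_within_subset)
    show "\<forall>\<^sub>F v in at_right lam. s * \<gamma> \<le> v + f v / 2"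
      using bound[OF s] by (simp add: eventually_at_filter)
  qed simp
  from this[of 1] this[of "-1"] have "\<bar>\<gamma>\<bar> \<le> lam" by auto
  then show ?thesis using True by (simp add: thr_def)
next
  case False
  obtain v where v: "lam < \<bar>v\<bar>" "f v = a" "thr lam f v = a"
    using range_thr_preimage[OF a False] by metis
  \<comment> \<open>Any point beyond \<open>\<bar>v\<bar>\<close> serves: it makes every
    \<open>b\<close> within \<open>f w - \<bar>a\<bar>\<close> of \<open>a\<close> an admissible
    competitor.\<close>
  define w where "w = \<bar>v\<bar> + 1"
  have "\<bar>f v\<bar> = f \<bar>v\<bar>"
    using act_nonneg[of "\<bar>v\<bar>"] act_odd[of "-v"] v(1) by (auto simp: abs_if)
  then have w: "lam < w" "\<bar>f v\<bar> < f w"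
    using act_strict_mono[of "\<bar>v\<bar>" w] v(1) by (auto simp: w_def)
  obtain C' where C': "(C has_real_derivative C') (at a)" "lam * C' = v - a"
    using cost_function_deriv[OF cost v(1) w] v(2) by metis
  have "lam * C' - \<gamma> = 0"
  proof (rule DERIV_local_min)
    show "((\<lambda>b. lam * C b - (b - a) * \<gamma> + (b - a)\<^sup>2 / 2) has_real_derivative lam * C' - \<gamma>) (at a)"
      using C'(1) by (auto intro!: derivative_eq_intros)
    show "0 < f w - \<bar>a\<bar>" using w v by simp
    show "\<forall>b. \<bar>a - b\<bar> < f w - \<bar>a\<bar> \<longrightarrow>
        lam * C a - (a - a) * \<gamma> + (a - a)\<^sup>2 / 2 \<le> lam * C b - (b - a) * \<gamma> + (b - a)\<^sup>2 / 2"
    proof (intro allI impI)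
      fix b assume "\<bar>a - b\<bar> < f w - \<bar>a\<bar>"
      then have "b \<in> {- f w..f w}" by auto
      then have "b \<in> range (thr lam f)" using interval_subset_range_thr[of w] w by auto
      from min[OF this] show "lam * C a - (a - a) * \<gamma> + (a - a)\<^sup>2 / 2 \<le> lam * C b - (b - a) * \<gamma> + (b - a)\<^sup>2 / 2"
        by (simp add: algebra_simps)
    qed
  qed
  then have "a + \<gamma> = v" using C'(2) by simp
  then show ?thesis using v by simp
qed

end

subsection \<open>Peano existence theorem\<close>

primrec euler :: "('a::real_vector \<Rightarrow> 'a) \<Rightarrow> real \<Rightarrow> 'a \<Rightarrow> nat \<Rightarrow> 'a" where
  "euler F h p 0 = p"
| "euler F h p (Suc j) = euler F h p j + h *\<^sub>R F (euler F h p j)"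

text \<open>Discrete Gronwall argument: one step multiplies \<open>1 + norm\<close> by at most
  \<open>1 + K * h \<le> exp (K * h)\<close>. The bound depends on the elapsed time
  \<open>h * j\<close> alone and is thus uniform in the step size.\<close>

lemma norm_euler_le:
  fixes F :: "'a::real_normed_vector \<Rightarrow> 'a"
  assumes "\<And>x. norm (F x) \<le> K * (1 + norm x)" "0 \<le> h" "0 \<le> K"
  shows "1 + norm (euler F h p j) \<le> (1 + norm p) * exp (K * (h * real j))"
proof (induction j)
  case (Suc j)
  let ?x = "euler F h p j"
  have "norm (euler F h p (Suc j)) \<le> norm ?x + h * norm (F ?x)"
    using norm_triangle_ineq[of ?x "h *\<^sub>R F ?x"] assms(2) by simp
  also have "\<dots> \<le> norm ?x + h * (K * (1 + norm ?x))"
    using assms by (intro add_left_mono mult_left_mono) auto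
  finally have "1 + norm (euler F h p (Suc j)) \<le> (1 + norm ?x) * (1 + K * h)"
    by (simp add: algebra_simps)
  also have "\<dots> \<le> ((1 + norm p) * exp (K * (h * real j))) * exp (K * h)"
    using Suc assms by (intro mult_mono) auto
  also have "\<dots> = (1 + norm p) * exp (K * (h * real (Suc j)))"
    by (simp add: exp_add[symmetric] algebra_simps)
  finally show ?case .
qed simp

text \<open>Comparison with motion at constant velocity \<open>c\<close>. With \<open>c = 0\<close>
  it gives a Lipschitz bound in time, with \<open>c\<close> the field at a limit point it gives the
  derivative of the limit.\<close>

lemma euler_increment:
  fixes F :: "'a::real_normed_vector \<Rightarrow> 'a"
  assumes "i \<le> j" "0 \<le> h"
    and "\<And>l. i \<le> l \<Longrightarrow> l < j \<Longrightarrow> norm (F (euler F h p l) - c) \<le> e"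
  shows "norm (euler F h p j - euler F h p i - (h * (real j - real i)) *\<^sub>R c)
         \<le> h * (real j - real i) * e"
  using assms(1,3)
proof (induction j rule: dec_induct)
  case (step n)
  let ?x = "\<lambda>j. euler F h p j"
  have "?x (Suc n) - ?x i - (h * (real (Suc n) - real i)) *\<^sub>R c
      = (?x n - ?x i - (h * (real n - real i)) *\<^sub>R c) + h *\<^sub>R (F (?x n) - c)"
    by (simp add: algebra_simps)
  also have "norm \<dots> \<le> h * (real n - real i) * e + h * e"
    using step assms(2)
    by (intro norm_triangle_mono) (auto intro!: mult_left_mono)
  finally show ?case by (simp add: algebra_simps)
qed simp

text \<open>The product of the balls is compact by Tychonoff's theorem, and countability of the
  index type turns this into sequential compactness, in place of a diagonal argument.\<close>

lemma subseq_pointwise_convergent: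
  fixes g :: "nat \<Rightarrow> 'b::countable \<Rightarrow> 'a::euclidean_space"
  assumes "\<And>k q. norm (g k q) \<le> R q"
  obtains r :: "nat \<Rightarrow> nat" where "strict_mono r" "\<And>q. convergent (\<lambda>k. g (r k) q)"
proof -
  have "compactin (product_topology (\<lambda>_. euclidean) UNIV) (\<Pi>\<^sub>E q\<in>UNIV. cball (0::'a) (R q))"
    by (subst compactin_PiE) auto
  then have "compact (\<Pi>\<^sub>E q\<in>UNIV. cball (0::'a) (R q))"
    by (simp add: euclidean_product_topology)
  then have "seq_compact (\<Pi>\<^sub>E q\<in>UNIV. cball (0::'a) (R q))"
    by (rule compact_imp_seq_compact)
  moreover have "\<forall>k. g k \<in> (\<Pi>\<^sub>E q\<in>UNIV. cball (0::'a) (R q))"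
    using assms by auto
  ultimately obtain l r where r: "strict_mono r" "(g \<circ> r) \<longlonglongrightarrow> l"
    by (metis seq_compactE)
  have "(\<lambda>k. (g \<circ> r) k q) \<longlonglongrightarrow> l q" for q
    by (rule continuous_on_tendsto_compose[OF continuous_on_product_coordinates[of q] r(2)]) auto
  then show thesis using that[OF r(1)] by (force simp: convergent_def)
qed


text \<open>Euler step functions converge along a subsequence, first at rational times and then at
  all nonnegative ones. Linear growth bounds them on every finite time interval, which rules out
  blow-up.\<close>

theorem peano_global:
  fixes F :: "'a::euclidean_space \<Rightarrow> 'a"
  assumes cont: "continuous_on UNIV F" and growth: "\<And>x. norm (F x) \<le> K * (1 + norm x)"
  obtains u where "u 0 = p" "\<And>t. t \<ge> 0 \<Longrightarrow> (u has_vector_derivative F (u t)) (at t within {0..})"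
proof -
  have K: "0 \<le> K" using growth[of 0] norm_ge_zero[of "F 0"] by (simp del: norm_ge_zero)
  define h where "h k = inverse (real (Suc k))" for k :: nat
  define N where "N k t = nat \<lfloor>t / h k\<rfloor>" for k and t :: real
  \<comment> \<open>Euler step functions. They need no interpolation: their jumps are of size \<open>O(h k)\<close>, which is
    enough for pointwise convergence on the rationals to propagate to all times.\<close>
  define s where "s k t = euler F (h k) p (N k t)" for k t
  \<comment> \<open>\<open>M R\<close> bounds the field on all Euler iterates up to time
    \<open>R\<close>, uniformly in the step size.\<close>
  define M where "M R = K * ((1 + norm p) * exp (K * R))" for R :: real
  have h_pos: "h k > 0" for k by (simp add: h_def)
  have h_lim: "h \<longlonglongrightarrow> 0" unfolding h_def[abs_def] by (rule LIMSEQ_inverse_real_of_nat)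
  have M_nonneg: "M R \<ge> 0" for R using K by (simp add: M_def)
  have N_le: "h k * real (N k t) \<le> t" if "t \<ge> 0" for k t
  proof -
    have "real (N k t) \<le> t / h k" using that h_pos[of k] by (simp add: N_def)
    then show ?thesis using h_pos[of k] by (simp add: field_simps)
  qed
  have N_gt: "t < h k * real (N k t) + h k" for k t
  proof -
    have "t / h k < real (N k t) + 1" unfolding N_def by linarith
    then show ?thesis using h_pos[of k] by (simp add: field_simps)
  qed
  have N_mono: "N k a \<le> N k b" if "a \<le> b" for k a b
    unfolding N_def using that h_pos[of k] by (intro nat_mono floor_mono divide_right_mono) auto
  have F_le: "norm (F (euler F (h k) p j)) \<le> M R" if "h k * real j \<le> R" for k j R
  proof -
    have "1 + norm (euler F (h k) p j) \<le> (1 + norm p) * exp (K * (h k * real j))"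
      by (rule norm_euler_le[OF growth]) (use h_pos[of k] K in auto)
    also have "\<dots> \<le> (1 + norm p) * exp (K * R)"
      using that K by (intro mult_left_mono) (auto intro: mult_left_mono)
    finally have "K * (1 + norm (euler F (h k) p j)) \<le> M R"
      unfolding M_def using K by (rule mult_left_mono)
    then show ?thesis using growth[of "euler F (h k) p j"] by linarith
  qed
  \<comment> \<open>The absolute value admits negative times, where \<open>N k t = 0\<close>, since
    the subsequence is chosen over all rationals.\<close>
  have s_le: "norm (s k t) \<le> (1 + norm p) * exp (K * \<bar>t\<bar>)" for k t
  proof -
    have "1 + norm (s k t) \<le> (1 + norm p) * exp (K * (h k * real (N k t)))"
      unfolding s_def by (rule norm_euler_le[OF growth]) (use h_pos[of k] K in auto)
    also have "h k * real (N k t) \<le> \<bar>t\<bar>"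
      using N_le[of t k] h_pos[of k] by (cases "t \<ge> 0") (auto simp: N_def divide_nonpos_pos)
    then have "(1 + norm p) * exp (K * (h k * real (N k t))) \<le> (1 + norm p) * exp (K * \<bar>t\<bar>)"
      using K by (intro mult_left_mono) (auto intro: mult_left_mono)
    finally show ?thesis by simp
  qed
  have euler_lip: "norm (euler F (h k) p j - euler F (h k) p i) \<le> h k * (real j - real i) * M R"
    if "i \<le> j" "h k * real j \<le> R" for i j k R
  proof -
    have "norm (F (euler F (h k) p l) - 0) \<le> M R" if "i \<le> l" "l < j" for l
    proof -
      have "h k * real l \<le> h k * real j" using that h_pos[of k] by (intro mult_left_mono) auto
      then show ?thesis using F_le[of k l R] \<open>h k * real j \<le> R\<close> by simp
    qed
    then have "norm (euler F (h k) p j - euler F (h k) p i - (h k * (real j - real i)) *\<^sub>R 0)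
        \<le> h k * (real j - real i) * M R"
      using h_pos[of k] that by (intro euler_increment) auto
    then show ?thesis by simp
  qed
  have s_lip: "norm (s k b - s k a) \<le> (b - a + h k) * M R" if "0 \<le> a" "a \<le> b" "b \<le> R" for a b k R
  proof -
    have "norm (s k b - s k a) \<le> h k * (real (N k b) - real (N k a)) * M R"
      unfolding s_def using N_mono[OF that(2)] N_le[of b k] that by (intro euler_lip) auto
    also have "\<dots> \<le> (b - a + h k) * M R"
      using N_le[of b k] N_gt[of a k] that M_nonneg[of R]
      by (intro mult_right_mono) (auto simp: algebra_simps)
    finally show ?thesis .
  qed
  obtain r where r: "strict_mono r" and conv_rat: "\<And>q::rat. convergent (\<lambda>k. s (r k) (of_rat q))"
    using subseq_pointwise_convergent[of "\<lambda>k q. s k (real_of_rat q)", OF s_le] by blast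
  have hr_lim: "(\<lambda>k. h (r k)) \<longlonglongrightarrow> 0"
    using LIMSEQ_subseq_LIMSEQ[OF h_lim r] by (simp add: o_def)
  have conv: "convergent (\<lambda>k. s (r k) t)" if t: "t \<ge> 0" for t
  proof (rule Cauchy_convergent, rule metric_CauchyI)
    fix e :: real assume e: "e > 0"
    \<comment> \<open>\<open>\<eta>\<close> will bound both the distance from \<open>t\<close> to a
      rational and the step size, so that the step functions move by less than \<open>e / 3\<close>
      between the two times.\<close>
    define \<eta> where "\<eta> = min 1 (e / (6 * (M (t + 1) + 1)))"
    have \<eta>: "0 < \<eta>" "\<eta> \<le> 1" using e M_nonneg[of "t + 1"] by (auto simp: \<eta>_def)
    have \<eta>M: "2 * \<eta> * M (t + 1) < e / 3"
    proof -
      have "2 * \<eta> * M (t + 1) < 2 * \<eta> * (M (t + 1) + 1)" using \<eta> by simp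
      also have "\<dots> \<le> 2 * (e / (6 * (M (t + 1) + 1))) * (M (t + 1) + 1)"
        using M_nonneg[of "t + 1"] by (intro mult_right_mono mult_left_mono) (auto simp: \<eta>_def)
      also have "\<dots> = e / 3" using M_nonneg[of "t + 1"] by (simp add: field_simps)
      finally show ?thesis .
    qed
    obtain q where q: "t < real_of_rat q" "real_of_rat q < t + \<eta>"
      using of_rat_dense[of t "t + \<eta>"] \<eta> by auto
    have "\<forall>\<^sub>F k in sequentially. h (r k) < \<eta>"
      using hr_lim \<eta>(1) by (rule order_tendstoD(2))
    then obtain k1 where k1: "\<And>k. k \<ge> k1 \<Longrightarrow> h (r k) < \<eta>"
      by (auto simp: eventually_sequentially)
    have close: "dist (s (r k) (of_rat q)) (s (r k) t) < e / 3" if "k \<ge> k1" for k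
    proof -
      have "norm (s (r k) (of_rat q) - s (r k) t) \<le> (of_rat q - t + h (r k)) * M (t + 1)"
        by (rule s_lip) (use t q \<eta> in auto)
      also have "\<dots> \<le> 2 * \<eta> * M (t + 1)"
        using q k1[OF that] M_nonneg by (intro mult_right_mono) auto
      finally show ?thesis using \<eta>M by (simp add: dist_norm)
    qed
    have "Cauchy (\<lambda>k. s (r k) (of_rat q))" using conv_rat convergent_Cauchy by blast
    then obtain k2 where k2: "\<And>m n. m \<ge> k2 \<Longrightarrow> n \<ge> k2 \<Longrightarrow>
        dist (s (r m) (of_rat q)) (s (r n) (of_rat q)) < e / 3"
      using metric_CauchyD[of _ "e / 3"] e by (meson divide_pos_pos zero_less_numeral)
    show "\<exists>k0. \<forall>m\<ge>k0. \<forall>n\<ge>k0. dist (s (r m) t) (s (r n) t) < e"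
    proof (intro exI allI impI)
      fix m n assume "max k1 k2 \<le> m" "max k1 k2 \<le> n"
      then have "dist (s (r m) (of_rat q)) (s (r m) t) < e / 3" "dist (s (r n) (of_rat q)) (s (r n) t) < e / 3"
        "dist (s (r m) (of_rat q)) (s (r n) (of_rat q)) < e / 3"
        using close k2 by auto
      then show "dist (s (r m) t) (s (r n) t) < e"
        by metric
    qed
  qed
  define u where "u t = lim (\<lambda>k. s (r k) t)" for t
  have u_lim: "(\<lambda>k. s (r k) t) \<longlonglongrightarrow> u t" if "t \<ge> 0" for t
    using conv[OF that] by (simp add: u_def convergent_LIMSEQ_iff)
  have hN_lim: "(\<lambda>k. h (r k) * real (N (r k) t)) \<longlonglongrightarrow> t" if "t \<ge> 0" for t
  proof (rule tendsto_sandwich[of "\<lambda>k. t - h (r k)" _ _ "\<lambda>_. t"])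
    show "\<forall>\<^sub>F k in sequentially. t - h (r k) \<le> h (r k) * real (N (r k) t)"
    proof (rule always_eventually, rule allI)
      fix k show "t - h (r k) \<le> h (r k) * real (N (r k) t)" using N_gt[of t "r k"] by linarith
    qed
    show "(\<lambda>k. t - h (r k)) \<longlonglongrightarrow> t" using tendsto_diff[OF tendsto_const hr_lim, of t] by simp
  qed (use N_le[OF that] in auto)
  \<comment> \<open>Letting \<open>t\<close> be either endpoint covers right and left difference
    quotients at once. The iterates between \<open>a\<close> and \<open>b\<close> stay within
    \<open>\<rho>\<close> of \<open>u t\<close>: half of it comes from the speed bound over a time
    of at most \<open>2 * d\<close>, half from convergence at \<open>t\<close>.\<close>
  have u_increment: "norm (u b - u a - (b - a) *\<^sub>R F (u t)) \<le> (b - a) * e"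
    if ab: "0 \<le> a" "a \<le> b" "b \<le> t + 1" and t: "t = a \<or> t = b"
      and \<rho>: "\<rho> > 0" "\<And>x. norm (x - u t) < \<rho> \<Longrightarrow> norm (F x - F (u t)) \<le> e"
      and d: "0 < d" "b - a < d" "2 * d * M (t + 1) \<le> \<rho> / 2" for a b t e \<rho> d
  proof -
    have "0 \<le> t" using t ab by auto
    have "\<forall>\<^sub>F k in sequentially. h (r k) < d" using hr_lim d(1) by (rule order_tendstoD(2))
    moreover have "\<forall>\<^sub>F k in sequentially. dist (s (r k) t) (u t) < \<rho> / 2"
      using u_lim[OF \<open>0 \<le> t\<close>] \<rho>(1) by (intro tendstoD) auto
    ultimately have "\<forall>\<^sub>F k in sequentially.
        norm (s (r k) b - s (r k) a - (h (r k) * real (N (r k) b) - h (r k) * real (N (r k) a)) *\<^sub>R F (u t))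
        \<le> (h (r k) * real (N (r k) b) - h (r k) * real (N (r k) a)) * e"
    proof eventually_elim
      case (elim k)
      let ?k = "r k"
      let ?x = "euler F (h ?k) p"
      have Nab: "N ?k a \<le> N ?k b" using ab by (intro N_mono)
      have hN: "h ?k * real (N ?k b) \<le> t + 1" using N_le[of b ?k] ab by linarith
      have width: "h ?k * (real (N ?k b) - real (N ?k a)) \<le> 2 * d"
        using N_le[of b ?k] N_gt[of a ?k] ab d elim by (simp add: algebra_simps)
      have "norm (F (?x l) - F (u t)) \<le> e" if l: "N ?k a \<le> l" "l < N ?k b" for l
      proof (rule \<rho>(2))
        have hl: "h ?k * real l \<le> t + 1"
          using l h_pos[of ?k] order_trans[OF mult_left_mono[of "real l" "real (N ?k b)" "h ?k"] hN] by simp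
        have "norm (?x l - ?x (N ?k t)) \<le> h ?k * (real (N ?k b) - real (N ?k a)) * M (t + 1)"
          using t
        proof
          assume "t = a"
          have "norm (?x l - ?x (N ?k a)) \<le> h ?k * (real l - real (N ?k a)) * M (t + 1)"
            using l hl by (intro euler_lip) auto
          also have "\<dots> \<le> h ?k * (real (N ?k b) - real (N ?k a)) * M (t + 1)"
            using l h_pos[of ?k] M_nonneg by (intro mult_right_mono mult_left_mono) auto
          finally show ?thesis using \<open>t = a\<close> by simp
        next
          assume "t = b"
          have "norm (?x (N ?k b) - ?x l) \<le> h ?k * (real (N ?k b) - real l) * M (t + 1)"
            using l hN by (intro euler_lip) auto
          also have "\<dots> \<le> h ?k * (real (N ?k b) - real (N ?k a)) * M (t + 1)"
            using l h_pos[of ?k] M_nonneg by (intro mult_right_mono mult_left_mono) auto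
          finally show ?thesis using \<open>t = b\<close> by (simp add: norm_minus_commute)
        qed
        also have "\<dots> \<le> 2 * d * M (t + 1)" using width M_nonneg by (intro mult_right_mono) auto
        also have "\<dots> \<le> \<rho> / 2" by (rule d(3))
        finally have "dist (?x l) (s ?k t) \<le> \<rho> / 2" by (simp add: s_def dist_norm)
        then have "dist (?x l) (u t) < \<rho>" using elim(2) by metric
        then show "norm (?x l - u t) < \<rho>" by (simp add: dist_norm)
      qed
      then have "norm (?x (N ?k b) - ?x (N ?k a) - (h ?k * (real (N ?k b) - real (N ?k a))) *\<^sub>R F (u t))
          \<le> h ?k * (real (N ?k b) - real (N ?k a)) * e"
        using h_pos[of ?k] Nab by (intro euler_increment) auto
      then show ?case by (simp add: s_def right_diff_distrib)
    qed
    moreover have "0 \<le> b" using ab by simp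
    ultimately show ?thesis
      using ab by (intro tendsto_le[OF _ _ tendsto_norm]) (auto intro!: tendsto_intros u_lim hN_lim)
  qed
  have "(u has_vector_derivative F (u t)) (at t within {0..})" if t: "t \<ge> 0" for t
    unfolding has_vector_derivative_def has_derivative_within_alt
  proof (intro conjI allI impI)
    show "bounded_linear (\<lambda>x. x *\<^sub>R F (u t))" by (rule bounded_linear_scaleR_left)
    fix e :: real assume "e > 0"
    moreover have "isCont F (u t)" using cont by (simp add: continuous_on_eq_continuous_at)
    ultimately obtain \<rho> where \<rho>: "\<rho> > 0" "\<And>x. norm (x - u t) < \<rho> \<Longrightarrow> norm (F x - F (u t)) < e"
      unfolding continuous_at_eps_delta dist_norm by metis
    define d where "d = min 1 (\<rho> / (4 * (M (t + 1) + 1)))"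
    have d: "0 < d" "d \<le> 1" using \<rho> M_nonneg[of "t + 1"] by (auto simp: d_def)
    have dM: "2 * d * M (t + 1) \<le> \<rho> / 2"
    proof -
      have "2 * d * M (t + 1) \<le> 2 * d * (M (t + 1) + 1)" using d by simp
      also have "\<dots> \<le> 2 * (\<rho> / (4 * (M (t + 1) + 1))) * (M (t + 1) + 1)"
        using M_nonneg[of "t + 1"] by (intro mult_right_mono mult_left_mono) (auto simp: d_def)
      also have "\<dots> = \<rho> / 2" using M_nonneg[of "t + 1"] by (simp add: field_simps)
      finally show ?thesis .
    qed
    have "norm (u v - u t - (v - t) *\<^sub>R F (u t)) \<le> e * norm (v - t)"
      if v: "v \<ge> 0" "norm (v - t) < d" for v
    proof (cases "t \<le> v")
      case True
      then have "norm (u v - u t - (v - t) *\<^sub>R F (u t)) \<le> (v - t) * e"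
        using v t d by (intro u_increment[OF _ _ _ _ \<rho>(1) _ d(1) _ dM] less_imp_le[OF \<rho>(2)]) auto
      then show ?thesis using True by (simp add: mult.commute)
    next
      case False
      then have "norm (u t - u v - (t - v) *\<^sub>R F (u t)) \<le> (t - v) * e"
        using v t d by (intro u_increment[OF _ _ _ _ \<rho>(1) _ d(1) _ dM] less_imp_le[OF \<rho>(2)]) auto
      moreover have "u v - u t - (v - t) *\<^sub>R F (u t) = - (u t - u v - (t - v) *\<^sub>R F (u t))"
        by (simp add: algebra_simps)
      ultimately show ?thesis using False by (simp only: norm_minus_cancel) (simp add: mult.commute)
    qed
    then show "\<exists>d>0. \<forall>v\<in>{0..}. norm (v - t) < d \<longrightarrow>
        norm (u v - u t - (v - t) *\<^sub>R F (u t)) \<le> e * norm (v - t)"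
      using d(1) by auto
  qed
  moreover have "u 0 = p"
    using LIMSEQ_unique[OF u_lim[of 0]] by (simp add: s_def N_def)
  ultimately show thesis using that by blast
qed

subsection \<open>Decay and convergence along trajectories\<close>

text \<open>Integrating factor: \<open>E t * exp (k * t)\<close> has a nonpositive
  derivative.\<close>

lemma exp_decay:
  fixes E :: "real \<Rightarrow> real"
  assumes E: "\<And>t. t \<ge> 0 \<Longrightarrow> (E has_real_derivative E' t) (at t within {0..})"
    and le: "\<And>t. t \<ge> 0 \<Longrightarrow> E' t \<le> - k * E t" and "t \<ge> 0"
  shows "E t \<le> E 0 * exp (- k * t)"
proof -
  define G where "G s = E s * exp (k * s)" for s
  have deriv: "(G has_real_derivative (E' s + k * E s) * exp (k * s)) (at s within {0..})" if "s \<ge> 0" for s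
    unfolding G_def[abs_def] using E[OF that] by (auto intro!: derivative_eq_intros simp: algebra_simps)
  have "G t \<le> G 0"
  proof (cases "t = 0")
    case False
    show ?thesis
    proof (rule DERIV_nonpos_imp_decreasing_open[of 0 t G])
      fix s assume s: "0 < s" "s < t"
      have "at s within {0..} = at s" using s by (intro at_within_interior) auto
      moreover have "(E' s + k * E s) * exp (k * s) \<le> 0"
        using le[of s] s by (intro mult_nonpos_nonneg) auto
      ultimately show "\<exists>y. (G has_real_derivative y) (at s) \<and> y \<le> 0"
        using deriv[of s] s by auto
    next
      have "continuous_on {0..} G"
        using deriv by (intro continuous_at_imp_continuous_on continuous_on_eq_continuous_within[THEN iffD2] ballI)
          (auto intro: DERIV_continuous simp: continuous_on_eq_continuous_within)
      then show "continuous_on {0..t} G" by (rule continuous_on_subset) auto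
    qed (use \<open>t \<ge> 0\<close> in auto)
  qed simp
  then show ?thesis by (simp add: G_def exp_minus field_simps)
qed

text \<open>A trajectory that never entered the ball of radius \<open>e\<close> would remain in a
  compact shell, where \<open>q\<close> has a negative maximum, and its squared norm would become
  negative in finite time. Once inside the ball it stays there, because the squared norm does not
  increase.\<close>

lemma strict_lyapunov_tendsto:
  fixes x :: "real \<Rightarrow> 'a::euclidean_space"
  assumes deriv: "\<And>t. t \<ge> 0 \<Longrightarrow> ((\<lambda>t. (norm (x t))\<^sup>2) has_real_derivative q (x t)) (at t within {0..})"
    and cont: "continuous_on UNIV q" and neg: "\<And>z. z \<noteq> 0 \<Longrightarrow> q z < 0"
  shows "(x \<longlongrightarrow> 0) at_top"
proof -
  define V where "V t = (norm (x t))\<^sup>2" for t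
  have deriv': "(V has_real_derivative q (x t)) (at t)" if "t > 0" for t
    using deriv[of t] that at_within_interior[of t "{0..}"] by (simp add: V_def[abs_def])
  have contV: "continuous_on {0..} V"
    using deriv by (auto simp: V_def[abs_def] continuous_on_eq_continuous_within intro: DERIV_continuous)
  have decr: "V b \<le> V a - m * (b - a)"
    if ab: "0 \<le> a" "a \<le> b" and m: "\<And>t. a < t \<Longrightarrow> t < b \<Longrightarrow> q (x t) \<le> - m" for a b m
  proof (cases "a = b")
    case False
    then have "a < b" using ab by simp
    moreover have "continuous_on {a..b} V"
      using contV ab by (auto intro: continuous_on_subset)
    moreover have "V differentiable at z" if "a < z" for z
      using deriv'[of z] that ab real_differentiable_def by auto
    ultimately obtain l z where z: "a < z" "z < b" "(V has_real_derivative l) (at z)" "V b - V a = (b - a) * l"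
      using MVT[of a b V] by metis
    then have "l = q (x z)" using deriv'[of z] ab DERIV_unique by auto
    then have "(b - a) * l \<le> (b - a) * - m" using m z ab by (intro mult_left_mono) auto
    then show ?thesis using z(4) by (simp add: algebra_simps)
  qed simp
  \<comment> \<open>At the origin the sign follows from nearby points by continuity.\<close>
  have nonpos: "q z \<le> 0" for z
  proof (cases "z = 0")
    case True
    have "(q \<longlongrightarrow> q 0) (at (0::'a))"
      using cont by (simp add: continuous_on_eq_continuous_at isCont_def)
    moreover have "\<forall>\<^sub>F z in at (0::'a). q z \<le> 0"
      using neg by (auto simp: eventually_at_filter less_imp_le)
    ultimately have "q 0 \<le> 0"
      by (rule tendsto_upperbound) simp
    then show ?thesis using True by simp
  qed (use neg in \<open>auto intro: less_imp_le\<close>)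
  have mono: "V b \<le> V a" if "0 \<le> a" "a \<le> b" for a b
    using decr[of a b 0] that nonpos by simp
  show ?thesis
  proof (rule tendstoI)
    fix e :: real assume e: "e > 0"
    have "\<exists>T\<ge>0. norm (x T) < e"
    proof (rule ccontr)
      assume "\<not> (\<exists>T\<ge>0. norm (x T) < e)"
      then have far: "e \<le> norm (x t)" if "t \<ge> 0" for t using that by auto
      define S where "S = cball (0::'a) (norm (x 0)) - ball 0 e"
      have S: "x t \<in> S" if "t \<ge> 0" for t
        using mono[of 0 t] far[OF that] that by (auto simp: S_def V_def abs_le_square_iff[symmetric])
      have "compact S" unfolding S_def by (intro compact_diff) auto
      moreover have "S \<noteq> {}" using S[of 0] by auto
      ultimately obtain z where z: "z \<in> S" "\<And>w. w \<in> S \<Longrightarrow> q w \<le> q z"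
        using continuous_attains_sup[of S q] continuous_on_subset[OF cont, of S] by auto
      have "q z < 0" using z(1) e by (intro neg) (auto simp: S_def)
      \<comment> \<open>By this time a decrease at rate \<open>- q z\<close> has brought
        \<open>V\<close> from \<open>V 0\<close> down to -1.\<close>
      define T where "T = (V 0 + 1) / (- q z)"
      have "T \<ge> 0" using \<open>q z < 0\<close> by (auto simp: T_def V_def intro!: divide_nonneg_nonpos)
      have "V T \<le> V 0 - (- q z) * (T - 0)"
        using \<open>T \<ge> 0\<close> z(2) S by (intro decr) auto
      also have "\<dots> = - 1" using \<open>q z < 0\<close> by (simp add: T_def field_simps)
      finally show False using zero_le_power2[of "norm (x T)"] by (simp add: V_def)
    qed
    then obtain T where T: "T \<ge> 0" "norm (x T) < e" by blast
    have "norm (x t) < e" if "t \<ge> T" for t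
      using mono[of T t] that T by (auto simp: V_def abs_le_square_iff[symmetric])
    then show "\<forall>\<^sub>F t in at_top. dist (x t) 0 < e"
      by (auto simp: eventually_at_top_linorder)
  qed
qed

text \<open>At a late enough time \<open>g\<close> lies on the same side of \<open>w\<close> as its
  limit, and the intermediate value theorem applies between \<open>t\<close> and that time. The
  inequalities are strict because the limit may never be attained.\<close>

lemma limit_between_visited:
  fixes g :: "real \<Rightarrow> real"
  assumes cont: "continuous_on {0..} g" and lim: "(g \<longlongrightarrow> l) at_top" and "0 \<le> t"
    and w: "min l (g t) < w" "w < max l (g t)"
  obtains s where "0 \<le> s" "g s = w"
proof -
  have c: "continuous_on {t..T} g" for T
    using cont \<open>0 \<le> t\<close> by (auto intro: continuous_on_subset)
  consider "l < w" "w < g t" | "g t < w" "w < l"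
    using w by (auto simp: min_def max_def split: if_splits)
  then show thesis
  proof cases
    case 1
    have "\<forall>\<^sub>F s in at_top. g s < w" using lim 1 by (auto intro: order_tendstoD)
    then obtain T where T: "T \<ge> t" "g T < w"
      unfolding eventually_at_top_linorder by (metis linorder_linear order_refl)
    then show ?thesis using IVT2'[of g T w t] c 1 \<open>0 \<le> t\<close> by (metis less_imp_le order_trans that)
  next
    case 2
    have "\<forall>\<^sub>F s in at_top. w < g s" using lim 2 by (auto intro: order_tendstoD)
    then obtain T where T: "T \<ge> t" "w < g T"
      unfolding eventually_at_top_linorder by (metis linorder_linear order_refl)
    then show ?thesis using IVT'[of g t w T] c 2 \<open>0 \<le> t\<close> by (metis less_imp_le order_trans that)
  qed
qed

subsection \<open>The quadratic form of the Gram matrix\<close>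

definition gram_form :: "real^'n^'m \<Rightarrow> real^'n \<Rightarrow> real^'n \<Rightarrow> real" where
  "gram_form \<Phi> w a = w \<bullet> ((transpose \<Phi> ** \<Phi> - mat 1) *v a)"

lemma gram_form_eq: "gram_form \<Phi> w a = (\<Phi> *v w) \<bullet> (\<Phi> *v a) - w \<bullet> a"
proof -
  have "w \<bullet> (transpose \<Phi> *v (\<Phi> *v a)) = (\<Phi> *v w) \<bullet> (\<Phi> *v a)"
    by (metis dot_lmul_matrix inner_commute transpose_matrix_vector transpose_transpose)
  then show ?thesis
    by (simp add: gram_form_def matrix_vector_mult_diff_rdistrib matrix_vector_mul_assoc[symmetric] inner_diff_right)
qed

lemma gram_form_self: "gram_form \<Phi> x x = (norm (\<Phi> *v x))\<^sup>2 - (norm x)\<^sup>2"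
  by (simp add: gram_form_eq power2_norm_eq_inner)

lemma gram_form_polarization: "4 * gram_form \<Phi> w a = gram_form \<Phi> (w + a) (w + a) - gram_form \<Phi> (w - a) (w - a)"
  by (simp add: gram_form_eq matrix_vector_right_distrib matrix_vector_mult_diff_distrib inner_commute algebra_simps)

lemma gram_form_scale_right: "gram_form \<Phi> w (c *\<^sub>R a) = c * gram_form \<Phi> w a"
  by (simp add: gram_form_def matrix_vector_mult_scaleR)

text \<open>Polarization and the parallelogram law. The bound is assumed at the two vectors
  \<open>w + a\<close> and \<open>w - a\<close> only, so the lemma serves both the global constant
  and the isometry constant of a support set.\<close>

lemma gram_form_le:
  assumes "\<bar>gram_form \<Phi> (w + a) (w + a)\<bar> \<le> d * (norm (w + a))\<^sup>2"
    and "\<bar>gram_form \<Phi> (w - a) (w - a)\<bar> \<le> d * (norm (w - a))\<^sup>2"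
  shows "\<bar>gram_form \<Phi> w a\<bar> \<le> d / 2 * ((norm w)\<^sup>2 + (norm a)\<^sup>2)"
proof -
  have "\<bar>4 * gram_form \<Phi> w a\<bar> \<le> d * ((norm (w + a))\<^sup>2 + (norm (w - a))\<^sup>2)"
    unfolding gram_form_polarization using assms by (auto simp: algebra_simps abs_le_iff)
  also have "(norm (w + a))\<^sup>2 + (norm (w - a))\<^sup>2 = 2 * ((norm w)\<^sup>2 + (norm a)\<^sup>2)"
    by (simp add: power2_norm_eq_inner inner_commute algebra_simps)
  finally show ?thesis by (simp add: abs_mult algebra_simps)
qed

text \<open>The maximum of the form over the unit sphere, extended by homogeneity. Minimality of
  \<open>D\<close> is what permits its comparison with \<open>\<delta>\<close>.\<close>

lemma gram_form_extremal:
  fixes \<Phi> :: "real^'n^'m"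
  obtains D where "0 \<le> D" "\<And>x. \<bar>gram_form \<Phi> x x\<bar> \<le> D * (norm x)\<^sup>2"
    "\<And>d. (\<And>x. \<bar>gram_form \<Phi> x x\<bar> \<le> d * (norm x)\<^sup>2) \<Longrightarrow> D \<le> d"
proof -
  have "continuous_on (sphere 0 1) (\<lambda>x. \<bar>gram_form \<Phi> x x\<bar>)"
    unfolding gram_form_def
    by (intro continuous_intros linear_continuous_on matrix_vector_mul_bounded_linear)
  moreover have "sphere (0::real^'n) 1 \<noteq> {}" by simp
  ultimately obtain z where z: "z \<in> sphere 0 1"
    "\<And>x. x \<in> sphere 0 1 \<Longrightarrow> \<bar>gram_form \<Phi> x x\<bar> \<le> \<bar>gram_form \<Phi> z z\<bar>"
    using continuous_attains_sup[of "sphere (0::real^'n) 1" "\<lambda>x. \<bar>gram_form \<Phi> x x\<bar>"] by auto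
  have hom: "gram_form \<Phi> (c *\<^sub>R x) (c *\<^sub>R x) = c\<^sup>2 * gram_form \<Phi> x x" for c x
    by (simp add: gram_form_eq matrix_vector_mult_scaleR power2_eq_square algebra_simps)
  show thesis
  proof (rule that[of "\<bar>gram_form \<Phi> z z\<bar>"])
    fix x
    show "\<bar>gram_form \<Phi> x x\<bar> \<le> \<bar>gram_form \<Phi> z z\<bar> * (norm x)\<^sup>2"
    proof (cases "x = 0")
      case False
      have "\<bar>gram_form \<Phi> x x\<bar> = (norm x)\<^sup>2 * \<bar>gram_form \<Phi> (x /\<^sub>R norm x) (x /\<^sub>R norm x)\<bar>"
        using False by (simp add: hom abs_mult power_inverse[symmetric] field_simps)
      also have "\<dots> \<le> (norm x)\<^sup>2 * \<bar>gram_form \<Phi> z z\<bar>"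
        using False by (intro mult_left_mono z(2)) auto
      finally show ?thesis by (simp add: mult.commute)
    qed (simp add: gram_form_def)
  next
    fix d assume "\<And>x. \<bar>gram_form \<Phi> x x\<bar> \<le> d * (norm x)\<^sup>2"
    from this[of z] show "\<bar>gram_form \<Phi> z z\<bar> \<le> d" using z(1) by simp
  qed simp
qed

text \<open>The isometry condition speaks of vectors with support exactly \<open>S\<close>. Adding a
  small \<open>e\<close> to every entry in \<open>S\<close> fills the support for all but finitely
  many \<open>e\<close>, and the inequality survives the limit.\<close>

lemma gram_form_sparse_bound:
  assumes bound: "\<And>x. active_set x = S \<Longrightarrow> \<bar>gram_form \<Phi> x x\<bar> \<le> d * (norm x)\<^sup>2"
    and x: "active_set x \<subseteq> S"
  shows "\<bar>gram_form \<Phi> x x\<bar> \<le> d * (norm x)\<^sup>2"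
proof -
  define z where "z e = (\<chi> n. x $ n + (if n \<in> S then e else 0))" for e :: real
  have z_lim: "(z \<longlongrightarrow> x) (at_right 0)"
    unfolding z_def[abs_def]
  proof (rule vec_tendstoI, simp)
    fix n show "((\<lambda>e. x $ n + (if n \<in> S then e else 0)) \<longlongrightarrow> x $ n) (at_right 0)"
      by (cases "n \<in> S") (auto intro!: tendsto_eq_intros)
  qed
  have "\<forall>\<^sub>F e in at_right 0. n \<in> S \<longrightarrow> x $ n + e \<noteq> 0" for n
  proof -
    have "\<forall>\<^sub>F e in at_right 0. e \<noteq> - (x $ n)" by (rule eventually_neq_at_within)
    then show ?thesis by eventually_elim auto
  qed
  then have "\<forall>\<^sub>F e in at_right 0. \<forall>n. n \<in> S \<longrightarrow> x $ n + e \<noteq> 0"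
    by (rule eventually_all_finite)
  then have "\<forall>\<^sub>F e in at_right 0. \<bar>gram_form \<Phi> (z e) (z e)\<bar> \<le> d * (norm (z e))\<^sup>2"
  proof eventually_elim
    case (elim e)
    have "active_set (z e) = S"
      using elim x by (auto simp: active_set_def z_def split: if_splits)
    then show ?case by (rule bound)
  qed
  moreover have "((\<lambda>e. \<bar>gram_form \<Phi> (z e) (z e)\<bar>) \<longlongrightarrow> \<bar>gram_form \<Phi> x x\<bar>) (at_right 0)"
    unfolding gram_form_self
    by (intro tendsto_intros z_lim bounded_linear.tendsto[OF matrix_vector_mul_bounded_linear])
  moreover have "((\<lambda>e. d * (norm (z e))\<^sup>2) \<longlongrightarrow> d * (norm x)\<^sup>2) (at_right 0)"
    by (intro tendsto_intros z_lim)
  ultimately show ?thesis by (intro tendsto_le[of "at_right (0::real)"]) auto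
qed

section \<open>The soft threshold and its squared energy\<close>

text \<open>For positive \<open>lam\<close> at most one of the two positive parts is nonzero, so the
  square splits into two squared positive parts.\<close>

definition soft :: "real \<Rightarrow> real \<Rightarrow> real" where
  "soft lam x = max 0 (x - lam) - max 0 (- x - lam)"

lemma has_real_derivative_pos_part_squared:
  "((\<lambda>x. (max 0 x)\<^sup>2) has_real_derivative 2 * max 0 x) (at (x::real))"
proof -
  consider "x > 0" | "x < 0" | "x = 0" by linarith
  then show ?thesis
  proof cases
    case 1
    have "((\<lambda>x. x\<^sup>2) has_real_derivative 2 * max 0 x) (at x)"
      using 1 by (auto intro!: derivative_eq_intros)
    then show ?thesis
      by (rule has_field_derivative_transform_within_open[of _ _ _ "{0<..}"]) (use 1 in auto)
  next
    case 2
    have "((\<lambda>x. 0) has_real_derivative 2 * max 0 x) (at x)"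
      using 2 by (auto intro!: derivative_eq_intros)
    then show ?thesis
      by (rule has_field_derivative_transform_within_open[of _ _ _ "{..<0}"]) (use 2 in auto)
  next
    case 3
    have "((\<lambda>h. (max 0 h)\<^sup>2 / h) \<longlongrightarrow> 0) (at (0::real))"
    proof (rule Lim_null_comparison)
      show "\<forall>\<^sub>F h in at 0. norm ((max 0 h)\<^sup>2 / h) \<le> \<bar>h::real\<bar>"
        by (auto simp: eventually_at_filter max_def power2_eq_square)
      show "((\<lambda>h. \<bar>h::real\<bar>) \<longlongrightarrow> 0) (at 0)" by (auto intro!: tendsto_eq_intros)
    qed
    then show ?thesis using 3 by (simp add: DERIV_def)
  qed
qed

text \<open>Squaring smooths the kinks of the soft threshold at \<open>lam\<close> and
  \<open>-lam\<close>.\<close>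

lemma has_real_derivative_soft_squared:
  assumes "0 < lam"
  shows "((\<lambda>x. (soft lam x)\<^sup>2 / 2) has_real_derivative soft lam x) (at x)"
proof -
  have eq: "(\<lambda>x. (soft lam x)\<^sup>2 / 2) = (\<lambda>x. ((max 0 (x - lam))\<^sup>2 + (max 0 (- x - lam))\<^sup>2) / 2)"
    using assms by (intro ext) (auto simp: soft_def max_def power2_eq_square algebra_simps)
  have "((\<lambda>x. (max 0 (x - lam))\<^sup>2) has_real_derivative (2 * max 0 (x - lam)) * 1) (at x)"
    by (rule DERIV_chain2[OF has_real_derivative_pos_part_squared]) (auto intro!: derivative_eq_intros)
  moreover have "((\<lambda>x. (max 0 (- x - lam))\<^sup>2) has_real_derivative (2 * max 0 (- x - lam)) * (-1)) (at x)"
    by (rule DERIV_chain2[OF has_real_derivative_pos_part_squared]) (auto intro!: derivative_eq_intros)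
  ultimately have "((\<lambda>x. ((max 0 (x - lam))\<^sup>2 + (max 0 (- x - lam))\<^sup>2) / 2) has_real_derivative
      ((2 * max 0 (x - lam)) * 1 + (2 * max 0 (- x - lam)) * (-1)) / 2) (at x)"
    by (intro DERIV_cdivide DERIV_add)
  then show ?thesis unfolding eq by (simp add: soft_def diff_divide_distrib)
qed

subsection \<open>The network\<close>

lemma matrix_vector_mult_axis: "\<Phi> *v axis n h = h *\<^sub>R column n \<Phi>" for \<Phi> :: "real^'n^'m"
proof -
  have "axis n h = h *\<^sub>R axis n 1" by (simp add: axis_def vec_eq_iff)
  then show ?thesis by (simp add: matrix_vector_mult_scaleR matrix_vector_mult_basis)
qed

lemma transpose_mult_nth: "(transpose \<Phi> *v r) $ n = r \<bullet> column n \<Phi>" for \<Phi> :: "real^'n^'m"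
  by (simp add: matrix_vector_mult_def transpose_def column_def inner_vec_def mult.commute)

text \<open>Moving one coordinate by \<open>h\<close> along a unit column changes the quadratic part
  by \<open>h\<^sup>2 / 2\<close> minus \<open>h\<close> times the residual correlation, so
  optimality reduces to the scalar lemma in each coordinate.\<close>

lemma thr_vec_minimizer:
  fixes \<Phi> :: "real^'n^'m"
  assumes unit_columns: "\<And>n. norm (column n \<Phi>) = 1"
    and lam: "lam > 0" and act: "activation lam f"
    and cost: "cost_function lam f C" and minimizer: "objective_minimizer lam f C \<Phi> y a"
  shows "thr_vec lam f (a + transpose \<Phi> *v (y - \<Phi> *v a)) = a"
proof -
  define r where "r = y - \<Phi> *v a"
  have "thr lam f (a $ n + r \<bullet> column n \<Phi>) = a $ n" for n
  proof (rule scalar_minimizer_thr[OF lam act cost])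
    show "a $ n \<in> range (thr lam f)" using minimizer by (simp add: objective_minimizer_def)
    fix b assume b: "b \<in> range (thr lam f)"
    define h where "h = b - a $ n"
    have "\<forall>i. (a + axis n h) $ i \<in> range (thr lam f)"
      using minimizer b by (auto simp: objective_minimizer_def axis_def h_def)
    then have le: "objective lam C \<Phi> y a \<le> objective lam C \<Phi> y (a + axis n h)"
      using minimizer unfolding objective_minimizer_def by blast
    have "y - \<Phi> *v (a + axis n h) = r - h *\<^sub>R column n \<Phi>"
      by (simp add: r_def matrix_vector_right_distrib matrix_vector_mult_axis)
    moreover have "(norm (r - h *\<^sub>R column n \<Phi>))\<^sup>2 = (norm r)\<^sup>2 - 2 * h * (r \<bullet> column n \<Phi>) + h\<^sup>2"
    proof -
      have "column n \<Phi> \<bullet> column n \<Phi> = 1" using unit_columns[of n] by (simp add: norm_eq_1)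
      then show ?thesis unfolding power2_norm_eq_inner
        by (simp add: inner_diff_left inner_diff_right inner_commute power2_eq_square algebra_simps)
    qed
    moreover have "(\<Sum>i\<in>UNIV. C ((a + axis n h) $ i)) = (\<Sum>i\<in>UNIV. C (a $ i)) + (C b - C (a $ n))"
    proof -
      have "(\<Sum>i\<in>UNIV. C ((a + axis n h) $ i)) = C b + (\<Sum>i\<in>UNIV - {n}. C ((a + axis n h) $ i))"
        by (subst sum.remove[of UNIV n]) (auto simp: axis_def h_def)
      also have "(\<Sum>i\<in>UNIV - {n}. C ((a + axis n h) $ i)) = (\<Sum>i\<in>UNIV - {n}. C (a $ i))"
        by (intro sum.cong) (auto simp: axis_def)
      also have "\<dots> = (\<Sum>i\<in>UNIV. C (a $ i)) - C (a $ n)" by (simp add: sum_diff1)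
      finally show ?thesis by simp
    qed
    ultimately have "(norm r)\<^sup>2 / 2 + lam * (\<Sum>i\<in>UNIV. C (a $ i))
        \<le> ((norm r)\<^sup>2 - 2 * h * (r \<bullet> column n \<Phi>) + h\<^sup>2) / 2
          + lam * ((\<Sum>i\<in>UNIV. C (a $ i)) + (C b - C (a $ n)))"
      using le by (simp add: objective_def r_def[symmetric] del: vector_add_component)
    then have "0 \<le> - h * (r \<bullet> column n \<Phi>) + h\<^sup>2 / 2 + lam * (C b - C (a $ n))"
      by (simp add: distrib_left diff_divide_distrib add_divide_distrib)
    then show "(b - a $ n) * (r \<bullet> column n \<Phi>) - (b - a $ n)\<^sup>2 / 2 \<le> lam * (C b - C (a $ n))"
      unfolding h_def[symmetric] by simp
  qed
  then show ?thesis
    by (simp add: thr_vec_def vec_eq_iff transpose_mult_nth r_def del: transpose_matrix_vector)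
qed

lemma lca_equilibrium_of_output:
  fixes \<Phi> :: "real^'n^'m"
  assumes "thr_vec lam f (a + transpose \<Phi> *v (y - \<Phi> *v a)) = a"
  shows "lca_equilibrium lam f \<Phi> y (a + transpose \<Phi> *v (y - \<Phi> *v a))"
  unfolding lca_equilibrium_def lca_field_def assms
  by (simp add: matrix_vector_mult_diff_rdistrib matrix_vector_mult_diff_distrib
      matrix_vector_mul_assoc[symmetric])

text \<open>Subtracting the vanishing field at the equilibrium cancels the input \<open>y\<close>
  and leaves state and output errors alone.\<close>

lemma lca_field_diff_equilibrium:
  assumes "lca_equilibrium lam f \<Phi> y us"
  shows "lca_field lam f \<Phi> y x =
    - (x - us) - (transpose \<Phi> ** \<Phi> - mat 1) *v (thr_vec lam f x - thr_vec lam f us)"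
proof -
  have "lca_field lam f \<Phi> y x = lca_field lam f \<Phi> y x - lca_field lam f \<Phi> y us"
    using assms by (simp add: lca_equilibrium_def)
  then show ?thesis by (simp add: lca_field_def matrix_vector_mult_diff_distrib)
qed

lemma inner_lca_field:
  assumes "lca_equilibrium lam f \<Phi> y us"
  shows "w \<bullet> lca_field lam f \<Phi> y x =
    - (w \<bullet> (x - us)) - gram_form \<Phi> w (thr_vec lam f x - thr_vec lam f us)"
  unfolding lca_field_diff_equilibrium[OF assms] gram_form_def
  by (simp add: inner_diff_right)

lemma continuous_thr_vec:
  assumes "lam > 0" "activation lam f"
  shows "continuous_on S (thr_vec lam f :: real^'n \<Rightarrow> real^'n)"
  unfolding thr_vec_def[abs_def]
  by (intro continuous_on_vec_lambda continuous_on_compose2[OF continuous_thr[OF assms]] continuous_intros) auto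

lemma norm_thr_vec_le:
  assumes "lam > 0" "activation lam f"
  shows "norm (thr_vec lam f x) \<le> norm x"
  by (rule norm_le_componentwise_cart) (simp add: thr_vec_def abs_thr_le[OF assms])

text \<open>\<open>deriv f\<close> may be unbounded near \<open>lam\<close>, so the field need not
  be Lipschitz; it is continuous, and it grows linearly because thresholding does not increase the
  norm.\<close>

lemma lca_trajectory_exists:
  fixes \<Phi> :: "real^'n^'m"
  assumes lam: "lam > 0" and tau: "tau > 0" and act: "activation lam f"
  obtains u where "lca_trajectory tau lam f \<Phi> y u" "u 0 = p"
proof -
  let ?G = "transpose \<Phi> ** \<Phi> - mat 1"
  define F where "F x = (1 / tau) *\<^sub>R lca_field lam f \<Phi> y x" for x
  define B where "B = onorm ((*v) ?G)"
  have B: "norm (?G *v x) \<le> B * norm x" "0 \<le> B" for x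
    unfolding B_def by (auto intro: onorm onorm_pos_le matrix_vector_mul_bounded_linear)
  have cont: "continuous_on UNIV F"
    unfolding F_def[abs_def] lca_field_def
    by (intro continuous_intros continuous_thr_vec lam act
        bounded_linear.continuous_on[OF matrix_vector_mul_bounded_linear])
  have growth: "norm (F x) \<le> (1 / tau) * (1 + B + norm (transpose \<Phi> *v y)) * (1 + norm x)" for x
  proof -
    let ?c = "norm (transpose \<Phi> *v y)"
    have "norm (lca_field lam f \<Phi> y x) \<le> norm x + norm (?G *v thr_vec lam f x) + ?c"
      unfolding lca_field_def
      by (intro order_trans[OF norm_triangle_ineq] add_right_mono order_trans[OF norm_triangle_ineq4]) simp
    also have "norm (?G *v thr_vec lam f x) \<le> B * norm x"
      using B(1)[of "thr_vec lam f x"] mult_left_mono[OF norm_thr_vec_le[OF lam act, of x] B(2)] by linarith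
    finally have "norm (lca_field lam f \<Phi> y x) \<le> norm x + B * norm x + ?c" by simp
    also have "\<dots> \<le> (1 + B + ?c) * (1 + norm x)"
      using B(2) by (simp add: algebra_simps)
    finally have "(1 / tau) * norm (lca_field lam f \<Phi> y x) \<le> (1 / tau) * ((1 + B + ?c) * (1 + norm x))"
      using tau by (intro mult_left_mono) auto
    then show ?thesis using tau by (simp add: F_def mult.assoc)
  qed
  obtain u where "u 0 = p" "\<And>t. t \<ge> 0 \<Longrightarrow> (u has_vector_derivative F (u t)) (at t within {0..})"
    using peano_global[OF cont growth, of p] by blast
  then show thesis by (intro that[of u]) (auto simp: lca_trajectory_def F_def)
qed

lemma equilibrium_trajectory:
  assumes "lca_equilibrium lam f \<Phi> y v"
  shows "lca_trajectory tau lam f \<Phi> y (\<lambda>_. v)"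
  using assms by (auto simp: lca_trajectory_def lca_equilibrium_def)

lemma lca_trajectory_deriv:
  "lca_trajectory tau lam f \<Phi> y u \<Longrightarrow> t \<ge> 0 \<Longrightarrow>
    (u has_vector_derivative (1 / tau) *\<^sub>R lca_field lam f \<Phi> y (u t)) (at t within {0..})"
  by (simp add: lca_trajectory_def)

section \<open>Convergence to the equilibrium and its rate\<close>

lemma isometry_bound_gram:
  assumes "isometry_bound lam \<Phi> Gs u d" "t \<ge> 0" "active_set x \<subseteq> active_nodes lam (u t) \<union> Gs"
  shows "\<bar>gram_form \<Phi> x x\<bar> \<le> d * (norm x)\<^sup>2"
proof (rule gram_form_sparse_bound[OF _ assms(3)])
  fix x assume "active_set x = active_nodes lam (u t) \<union> Gs"
  then have "(1 - d) * (norm x)\<^sup>2 \<le> (norm (\<Phi> *v x))\<^sup>2" "(norm (\<Phi> *v x))\<^sup>2 \<le> (1 + d) * (norm x)\<^sup>2"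
    using assms(1,2) by (auto simp: isometry_bound_def)
  then show "\<bar>gram_form \<Phi> x x\<bar> \<le> d * (norm x)\<^sup>2"
    by (simp add: gram_form_self algebra_simps abs_le_iff)
qed

lemma lca_tendsto_equilibrium:
  fixes \<Phi> :: "real^'n^'m"
  assumes lam: "lam > 0" and tau: "tau > 0" and act: "activation lam f"
    and D: "0 \<le> D" "\<And>x. \<bar>gram_form \<Phi> x x\<bar> \<le> D * (norm x)\<^sup>2"
    and contr: "\<And>w. lam < w \<Longrightarrow> D * deriv f w < 1"
    and eq: "lca_equilibrium lam f \<Phi> y us" and traj: "lca_trajectory tau lam f \<Phi> y u"
  shows "(u \<longlongrightarrow> us) at_top"
proof -
  define a where "a z = thr_vec lam f (us + z) - thr_vec lam f us" for z
  \<comment> \<open>The derivative of the squared error along a trajectory, written as a function of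
    the error alone.\<close>
  define q where "q z = 2 / tau * (- (norm z)\<^sup>2 - gram_form \<Phi> z (a z))" for z
  have "((\<lambda>t. u t - us) \<longlongrightarrow> 0) at_top"
  proof (rule strict_lyapunov_tendsto[where q = q])
    fix t :: real assume t: "t \<ge> 0"
    let ?d = "(1 / tau) *\<^sub>R lca_field lam f \<Phi> y (u t)"
    have "((\<lambda>t. u t - us) has_vector_derivative ?d) (at t within {0..})"
      using lca_trajectory_deriv[OF traj t] by (auto intro!: derivative_eq_intros)
    from bounded_bilinear.has_vector_derivative[OF bounded_bilinear_inner this this]
    have "((\<lambda>t. (norm (u t - us))\<^sup>2) has_real_derivative (u t - us) \<bullet> ?d + ?d \<bullet> (u t - us)) (at t within {0..})"
      unfolding power2_norm_eq_inner has_real_derivative_iff_has_vector_derivative .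
    moreover have "(u t - us) \<bullet> ?d + ?d \<bullet> (u t - us) = q (u t - us)"
      using inner_lca_field[OF eq, of "u t - us" "u t"]
      by (simp add: q_def a_def inner_commute[of "lca_field lam f \<Phi> y (u t)"] power2_norm_eq_inner)
    ultimately show "((\<lambda>t. (norm (u t - us))\<^sup>2) has_real_derivative q (u t - us)) (at t within {0..})"
      by simp
  next
    have "continuous_on UNIV a"
      unfolding a_def[abs_def]
      by (intro continuous_intros continuous_on_compose2[OF continuous_thr_vec[OF lam act, of UNIV]]) auto
    then show "continuous_on UNIV q"
      unfolding q_def[abs_def] gram_form_def
      by (intro continuous_intros bounded_linear.continuous_on[OF matrix_vector_mul_bounded_linear])
  next
    fix z :: "real^'n" assume z: "z \<noteq> 0"
    have comp: "\<bar>D * a z $ n\<bar> \<le> \<bar>z $ n\<bar>" "z $ n \<noteq> 0 \<Longrightarrow> \<bar>D * a z $ n\<bar> < \<bar>z $ n\<bar>" for n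
      using thr_strict_contraction[OF lam act _ D(1) contr, of "us $ n" "us $ n + z $ n"]
      by (cases "z $ n = 0"; simp add: a_def thr_vec_def)+
    obtain m where "z $ m \<noteq> 0" using z by (auto simp: vec_eq_iff)
    have "(norm (D *\<^sub>R a z))\<^sup>2 < (norm z)\<^sup>2"
      unfolding power2_norm_eq_inner inner_vec_def
    proof (rule sum_strict_mono_ex1)
      show "\<forall>n\<in>UNIV. (D *\<^sub>R a z) $ n \<bullet> (D *\<^sub>R a z) $ n \<le> z $ n \<bullet> z $ n"
        using comp(1) by (simp add: abs_le_square_iff power2_eq_square)
      have "\<bar>D * a z $ m\<bar>\<^sup>2 < \<bar>z $ m\<bar>\<^sup>2"
        by (intro power_strict_mono comp(2) \<open>z $ m \<noteq> 0\<close>) auto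
      then show "\<exists>n\<in>UNIV. (D *\<^sub>R a z) $ n \<bullet> (D *\<^sub>R a z) $ n < z $ n \<bullet> z $ n"
        by (auto simp: power2_eq_square)
    qed simp
    have "\<bar>gram_form \<Phi> z (a z)\<bar> < (norm z)\<^sup>2"
    proof (cases "D = 0")
      case True
      then have "gram_form \<Phi> z (a z) = 0"
        using gram_form_le[of \<Phi> z "a z" 0] D(2) by simp
      then show ?thesis using z by simp
    next
      case False
      \<comment> \<open>Scaling by \<open>D\<close> brings the output error below \<open>z\<close>
        in norm, so \<open>gram_form_le\<close> gives a strict bound from which \<open>D\<close>
        cancels.\<close>
      have "D * \<bar>gram_form \<Phi> z (a z)\<bar> = \<bar>gram_form \<Phi> z (D *\<^sub>R a z)\<bar>"
        using D(1) by (simp add: gram_form_scale_right abs_mult)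
      also have "\<dots> \<le> D / 2 * ((norm z)\<^sup>2 + (norm (D *\<^sub>R a z))\<^sup>2)"
        by (intro gram_form_le D(2))
      also have "\<dots> < D / 2 * ((norm z)\<^sup>2 + (norm z)\<^sup>2)"
        using False D(1) \<open>(norm (D *\<^sub>R a z))\<^sup>2 < (norm z)\<^sup>2\<close> by (intro mult_strict_left_mono) auto
      finally have "D * \<bar>gram_form \<Phi> z (a z)\<bar> < D * (norm z)\<^sup>2" by simp
      then show ?thesis using False D(1) by simp
    qed
    then have "- (norm z)\<^sup>2 - gram_form \<Phi> z (a z) < 0" by (auto simp: abs_less_iff)
    then show "q z < 0" unfolding q_def using tau by (intro mult_pos_neg) auto
  qed
  then show ?thesis using tendsto_add[OF _ tendsto_const, of "\<lambda>t. u t - us" 0 at_top us] by simp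
qed

text \<open>The hypothesis \<open>lim\<close> serves to turn the pointwise bound
  \<open>\<alpha>\<close> into a Lipschitz constant; the rate comes from the energy of
  \<open>w\<close>.\<close>

lemma lca_exp_convergence:
  fixes \<Phi> :: "real^'n^'m"
  assumes lam: "lam > 0" and tau: "tau > 0" and act: "activation lam f"
    and eq: "lca_equilibrium lam f \<Phi> y us" and traj: "lca_trajectory tau lam f \<Phi> y u"
    and lim: "(u \<longlongrightarrow> us) at_top"
    and alpha: "alpha_constant lam f u \<alpha>" and "0 < \<delta>"
    and iso: "isometry_bound lam \<Phi> (active_set (thr_vec lam f us)) u \<delta>"
  shows "\<exists>\<kappa>>0. \<forall>t\<ge>0. norm (u t - us) \<le> \<kappa> * exp (- ((1 - \<alpha> * \<delta>) / tau) * t)"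
proof -
  define c where "c = (1 - \<alpha> * \<delta>) / tau"
  let ?G = "transpose \<Phi> ** \<Phi> - mat 1"
  let ?Gs = "active_set (thr_vec lam f us)"
  define a where "a t = thr_vec lam f (u t) - thr_vec lam f us" for t
  \<comment> \<open>The full error cannot replace \<open>w\<close> in the energy estimate, because the isometry bound only
    sees coordinates in the active set at time \<open>t\<close> joined with that of the equilibrium. The soft
    threshold vanishes on all other coordinates and keeps the energy differentiable when the
    active set changes.\<close>
  define w where "w t = (\<chi> n. if n \<in> ?Gs then u t $ n - us $ n else soft lam (u t $ n))" for t
  have \<alpha>: "0 \<le> \<alpha>" using alpha by (simp add: alpha_constant_def)
  have inactive: "\<bar>us $ n\<bar> \<le> lam" if "n \<notin> ?Gs" for n
    using that thr_eq_0_iff[OF lam act] by (simp add: active_set_def thr_vec_def)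
  have cont_u: "continuous_on {0..} (\<lambda>t. u t $ n)" for n
  proof -
    have "continuous_on {0..} u"
      using lca_trajectory_deriv[OF traj]
      by (auto simp: continuous_on_eq_continuous_within intro: has_vector_derivative_continuous)
    then show ?thesis by (intro continuous_intros)
  qed
  \<comment> \<open>The trajectory converges, so it later visits every value between \<open>u t $ n\<close> and its limit,
    and the bound \<open>\<alpha>\<close> along the trajectory controls \<open>f\<close> on the whole segment.\<close>
  have lipschitz: "\<bar>thr lam f (u t $ n) - thr lam f p\<bar> \<le> \<alpha> * \<bar>u t $ n - p\<bar>"
    if "t \<ge> 0" and p: "min (us $ n) (u t $ n) \<le> p" "p \<le> max (us $ n) (u t $ n)" for t n p
  proof (rule abs_thr_diff_le[OF lam act \<alpha>])
    fix z assume z: "min p (u t $ n) < z" "z < max p (u t $ n)" "lam < \<bar>z\<bar>"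
    have "min (us $ n) (u t $ n) < z" "z < max (us $ n) (u t $ n)"
      using z p by (auto simp: min_def max_def split: if_splits)
    then obtain s where "0 \<le> s" "u s $ n = z"
      by (rule limit_between_visited[OF cont_u tendsto_vec_nth[OF lim] \<open>t \<ge> 0\<close>])
    then have "\<bar>deriv f z\<bar> \<le> \<alpha>" using alpha z(3) by (auto simp: alpha_constant_def)
    then show "deriv f z \<le> \<alpha>" by simp
  qed
  have a_le: "\<bar>a t $ n\<bar> \<le> \<alpha> * \<bar>w t $ n\<bar>" if t: "t \<ge> 0" for t n
  proof (cases "n \<in> ?Gs")
    case True
    then show ?thesis using lipschitz[OF t, of n "us $ n"] by (simp add: a_def w_def thr_vec_def)
  next
    case False
    then have zero: "thr lam f (us $ n) = 0" by (simp add: active_set_def thr_vec_def)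
    \<comment> \<open>The equilibrium value lies in the dead zone, so an active node has
      \<open>lam\<close> or \<open>-lam\<close> between it and its limit. The output vanishes there,
      and the distance to that threshold is the modulus of \<open>w t $ n\<close>.\<close>
    consider "\<bar>u t $ n\<bar> \<le> lam" | "lam < u t $ n" | "u t $ n < - lam" by linarith
    then show ?thesis
    proof cases
      case 1
      then show ?thesis using False zero \<alpha> by (simp add: a_def w_def thr_vec_def) (simp add: thr_def)
    next
      case 2
      then show ?thesis using lipschitz[OF t, of n lam] False zero inactive[OF False] lam
        by (simp add: a_def w_def thr_vec_def soft_def thr_def[of lam f lam] abs_le_iff)
    next
      case 3
      then show ?thesis using lipschitz[OF t, of n "- lam"] False zero inactive[OF False] lam
        by (simp add: a_def w_def thr_vec_def soft_def thr_def[of lam f "- lam"] abs_le_iff minus_diff_commute)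
    qed
  qed
  have norm_a: "norm (a t) \<le> \<alpha> * norm (w t)" if "t \<ge> 0" for t
  proof -
    have "norm (a t) \<le> norm (\<alpha> *\<^sub>R w t)"
      by (rule norm_le_componentwise_cart) (use a_le[OF that] \<alpha> in \<open>simp add: abs_mult\<close>)
    then show ?thesis using \<alpha> by simp
  qed
  have active: "n \<in> active_nodes lam (u t) \<union> ?Gs" if "w t $ n \<noteq> 0 \<or> a t $ n \<noteq> 0" for n t
    using that by (auto simp: w_def a_def thr_vec_def thr_def active_nodes_def soft_def active_set_def split: if_splits)
  have gram_le: "\<bar>gram_form \<Phi> (w t) (a t)\<bar> \<le> \<alpha> * \<delta> * (norm (w t))\<^sup>2" if t: "t \<ge> 0" for t
  proof (cases "\<alpha> = 0")
    case True
    then have "a t = 0" using norm_a[OF t] by simp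
    then show ?thesis using True by (simp add: gram_form_def)
  next
    case False
    then have pos: "0 < \<alpha>" using \<alpha> by simp
    \<comment> \<open>Division by \<open>\<alpha>\<close> makes the output error no longer than
      \<open>w t\<close> and keeps its support.\<close>
    let ?b = "(1 / \<alpha>) *\<^sub>R a t"
    have b: "norm ?b \<le> norm (w t)" using norm_a[OF t] pos by (simp add: field_simps)
    have "\<bar>gram_form \<Phi> x x\<bar> \<le> \<delta> * (norm x)\<^sup>2" if "x = w t + ?b \<or> x = w t - ?b" for x
    proof (rule isometry_bound_gram[OF iso t], rule subsetI)
      fix n assume "n \<in> active_set x"
      then have "w t $ n \<noteq> 0 \<or> a t $ n \<noteq> 0" using that by (auto simp: active_set_def)
      then show "n \<in> active_nodes lam (u t) \<union> ?Gs" by (rule active)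
    qed
    then have "\<bar>gram_form \<Phi> (w t) ?b\<bar> \<le> \<delta> / 2 * ((norm (w t))\<^sup>2 + (norm ?b)\<^sup>2)"
      by (intro gram_form_le) auto
    also have "\<dots> \<le> \<delta> / 2 * ((norm (w t))\<^sup>2 + (norm (w t))\<^sup>2)"
      using \<open>0 < \<delta>\<close> b by (intro mult_left_mono add_left_mono power_mono) auto
    finally have "\<alpha> * \<bar>gram_form \<Phi> (w t) ?b\<bar> \<le> \<alpha> * (\<delta> * (norm (w t))\<^sup>2)"
      using \<alpha> by (intro mult_left_mono) auto
    then show ?thesis using pos unfolding gram_form_scale_right by (simp add: abs_mult mult.assoc)
  qed
  \<comment> \<open>Off \<open>?Gs\<close> the soft threshold has the sign of the error and at most
    its modulus, as the equilibrium value lies in the dead zone.\<close>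
  have w_inner: "(norm (w t))\<^sup>2 \<le> w t \<bullet> (u t - us)" for t
    unfolding power2_norm_eq_inner inner_vec_def
  proof (rule sum_mono)
    fix n
    show "w t $ n \<bullet> w t $ n \<le> w t $ n \<bullet> (u t - us) $ n"
    proof (cases "n \<in> ?Gs")
      case False
      then have "\<bar>us $ n\<bar> \<le> lam" by (rule inactive)
      then have "soft lam (u t $ n) * soft lam (u t $ n) \<le> soft lam (u t $ n) * (u t $ n - us $ n)"
        using lam by (auto simp: soft_def max_def abs_le_iff intro: mult_left_mono mult_left_mono_neg)
      then show ?thesis using False by (simp add: w_def)
    qed (simp add: w_def)
  qed
  define E where "E t = (norm (w t))\<^sup>2 / 2" for t
  have E_deriv: "(E has_real_derivative w t \<bullet> ((1 / tau) *\<^sub>R lca_field lam f \<Phi> y (u t))) (at t within {0..})"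
    if t: "t \<ge> 0" for t
  proof -
    have "((\<lambda>t. (w t $ n)\<^sup>2 / 2) has_real_derivative
        w t $ n * ((1 / tau) *\<^sub>R lca_field lam f \<Phi> y (u t)) $ n) (at t within {0..})" for n
    proof -
      have un: "((\<lambda>t. u t $ n) has_real_derivative ((1 / tau) *\<^sub>R lca_field lam f \<Phi> y (u t)) $ n) (at t within {0..})"
        unfolding has_real_derivative_iff_has_vector_derivative
        by (rule bounded_linear.has_vector_derivative[OF bounded_linear_vec_nth lca_trajectory_deriv[OF traj t]])
      show ?thesis
      proof (cases "n \<in> ?Gs")
        case True
        then show ?thesis using un by (auto simp: w_def intro!: derivative_eq_intros)
      next
        case False
        then show ?thesis using DERIV_chain2[OF has_real_derivative_soft_squared[OF lam] un]
          by (simp add: w_def)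
      qed
    qed
    then have "((\<lambda>t. \<Sum>n\<in>UNIV. (w t $ n)\<^sup>2 / 2) has_real_derivative
        (\<Sum>n\<in>UNIV. w t $ n * ((1 / tau) *\<^sub>R lca_field lam f \<Phi> y (u t)) $ n)) (at t within {0..})"
      by (intro DERIV_sum)
    moreover have "E = (\<lambda>t. \<Sum>n\<in>UNIV. (w t $ n)\<^sup>2 / 2)"
      unfolding E_def[abs_def] power2_norm_eq_inner inner_vec_def
      by (simp add: power2_eq_square sum_divide_distrib)
    ultimately show ?thesis by (simp add: inner_vec_def)
  qed
  \<comment> \<open>The leak removes at least the squared norm of \<open>w\<close>; the coupling
    restores at most \<open>\<alpha> * \<delta>\<close> times it.\<close>
  have E_decay: "E t \<le> E 0 * exp (- (2 * c) * t)" if "t \<ge> 0" for t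
  proof (rule exp_decay[OF E_deriv _ that])
    fix t :: real assume t: "t \<ge> 0"
    have "w t \<bullet> lca_field lam f \<Phi> y (u t) \<le> - (norm (w t))\<^sup>2 + \<alpha> * \<delta> * (norm (w t))\<^sup>2"
      unfolding inner_lca_field[OF eq] using w_inner[of t] gram_le[OF t] by (simp add: a_def)
    then have "(1 / tau) * (w t \<bullet> lca_field lam f \<Phi> y (u t)) \<le> (1 / tau) * (- (norm (w t))\<^sup>2 + \<alpha> * \<delta> * (norm (w t))\<^sup>2)"
      using tau by (intro mult_left_mono) auto
    also have "\<dots> = - (2 * c) * E t" using tau by (simp add: c_def E_def field_simps)
    finally show "w t \<bullet> ((1 / tau) *\<^sub>R lca_field lam f \<Phi> y (u t)) \<le> - (2 * c) * E t" by simp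
  qed
  have w_decay: "norm (w t) \<le> norm (w 0) * exp (- c * t)" if "t \<ge> 0" for t
  proof (rule power2_le_imp_le)
    have "(exp (- c * t))\<^sup>2 = exp (- (2 * c) * t)" by (simp add: exp_double[symmetric] algebra_simps)
    then show "(norm (w t))\<^sup>2 \<le> (norm (w 0) * exp (- c * t))\<^sup>2"
      using E_decay[OF that]
      by (simp add: E_def power_mult_distrib)
  qed simp
  define B where "B = onorm ((*v) ?G)"
  have B: "norm (?G *v x) \<le> B * norm x" "0 \<le> B" for x
    unfolding B_def by (auto intro: onorm onorm_pos_le matrix_vector_mul_bounded_linear)
  define M where "M = B * norm (w 0)"
  have M: "0 \<le> M" using B(2) by (simp add: M_def)
  have Ga: "norm (?G *v a t) \<le> \<alpha> * M * exp (- c * t)" if t: "t \<ge> 0" for t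
  proof -
    have "norm (?G *v a t) \<le> B * (\<alpha> * (norm (w 0) * exp (- c * t)))"
      using B(1)[of "a t"] mult_left_mono[OF order_trans[OF norm_a[OF t] mult_left_mono[OF w_decay[OF t] \<alpha>]] B(2)]
      by linarith
    then show ?thesis by (simp add: M_def mult_ac)
  qed
  have rate: "1 / tau - c = \<alpha> * \<delta> / tau" using tau by (simp add: c_def field_simps)
  \<comment> \<open>Variation of constants recovers the full error from \<open>w\<close>; the strict inequality
    \<open>0 < \<delta>\<close> rules out the resonance \<open>c = 1 / tau\<close> with a nonzero driving term.\<close>
  define z where "z t = exp (t / tau) *\<^sub>R (u t - us)" for t
  \<comment> \<open>The factor \<open>M / \<delta>\<close> makes the derivative of
    \<open>\<phi>\<close> equal to the bound on the speed of \<open>z\<close>.\<close>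
  define \<phi> where "\<phi> t = M / \<delta> * exp (\<alpha> * \<delta> / tau * t)" for t
  have z_deriv: "(z has_vector_derivative - (exp (t / tau) / tau) *\<^sub>R (?G *v a t)) (at t within {0..})"
    if t: "t \<ge> 0" for t
  proof -
    have "((\<lambda>t. u t - us) has_vector_derivative (1 / tau) *\<^sub>R (- (u t - us) - ?G *v a t)) (at t within {0..})"
      using lca_trajectory_deriv[OF traj t] unfolding lca_field_diff_equilibrium[OF eq] a_def
      by (auto intro!: derivative_eq_intros)
    moreover have "((\<lambda>t. exp (t / tau)) has_real_derivative exp (t / tau) / tau) (at t within {0..})"
      using tau by (auto intro!: derivative_eq_intros)
    ultimately have "(z has_vector_derivative exp (t / tau) *\<^sub>R ((1 / tau) *\<^sub>R (- (u t - us) - ?G *v a t))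
        + (exp (t / tau) / tau) *\<^sub>R (u t - us)) (at t within {0..})"
      unfolding z_def[abs_def] by (intro has_vector_derivative_scaleR)
    then show ?thesis by (simp add: algebra_simps)
  qed
  have z_le: "norm (z t - z 0) \<le> \<phi> t - \<phi> 0" if "t > 0" for t
  proof (rule differentiable_bound_general[OF that])
    have "continuous_on {0..} z"
      using z_deriv by (auto simp: continuous_on_eq_continuous_within intro: has_vector_derivative_continuous)
    then show "continuous_on {0..t} z" by (rule continuous_on_subset) auto
    show "continuous_on {0..t} \<phi>" unfolding \<phi>_def[abs_def] by (intro continuous_intros)
    fix s assume s: "0 < s" "s < t"
    show "(z has_vector_derivative - (exp (s / tau) / tau) *\<^sub>R (?G *v a s)) (at s)"
      using z_deriv[of s] s at_within_interior[of s "{0..}"] by simp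
    show "(\<phi> has_vector_derivative \<alpha> * M / tau * exp (\<alpha> * \<delta> / tau * s)) (at s)"
      unfolding \<phi>_def[abs_def] has_real_derivative_iff_has_vector_derivative[symmetric]
      using \<open>0 < \<delta>\<close> tau by (auto intro!: derivative_eq_intros)
    have "norm (- (exp (s / tau) / tau) *\<^sub>R (?G *v a s)) \<le> exp (s / tau) / tau * (\<alpha> * M * exp (- c * s))"
      using Ga[of s] s tau by (simp add: divide_right_mono)
    also have "\<dots> = \<alpha> * M / tau * exp ((1 / tau - c) * s)"
      by (simp add: exp_add[symmetric] algebra_simps)
    finally show "norm (- (exp (s / tau) / tau) *\<^sub>R (?G *v a s)) \<le> \<alpha> * M / tau * exp (\<alpha> * \<delta> / tau * s)"
      unfolding rate .
  qed
  \<comment> \<open>The summand 1 keeps \<open>\<kappa>\<close> positive when the trajectory starts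
    at the equilibrium.\<close>
  define \<kappa> where "\<kappa> = norm (u 0 - us) + M / \<delta> + 1"
  have "0 < \<kappa>" using M \<open>0 < \<delta>\<close> by (auto simp: \<kappa>_def intro!: add_nonneg_pos add_nonneg_nonneg)
  moreover have "norm (u t - us) \<le> \<kappa> * exp (- c * t)" if t: "t \<ge> 0" for t
  proof -
    let ?e = "exp (\<alpha> * \<delta> / tau * t)"
    have "1 \<le> ?e" using \<alpha> \<open>0 < \<delta>\<close> tau t by simp
    have "norm (z t) \<le> norm (z 0) + (\<phi> t - \<phi> 0)"
      using z_le[of t] t norm_triangle_sub[of "z t" "z 0"] by (cases "t = 0") auto
    also have "\<dots> \<le> norm (u 0 - us) * ?e + M / \<delta> * ?e"
    proof -
      have "0 \<le> M / \<delta>" using M \<open>0 < \<delta>\<close> by simp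
      then show ?thesis
        using mult_left_mono[OF \<open>1 \<le> ?e\<close>, of "norm (u 0 - us)"] by (simp add: z_def \<phi>_def)
    qed
    also have "\<dots> \<le> \<kappa> * ?e" by (simp add: \<kappa>_def algebra_simps)
    finally have "exp (- (t / tau)) * norm (z t) \<le> exp (- (t / tau)) * (\<kappa> * ?e)"
      by (intro mult_left_mono) auto
    moreover have "exp (- (t / tau)) * norm (z t) = norm (u t - us)"
      by (simp add: z_def exp_minus)
    moreover have "exp (- (t / tau)) * (\<kappa> * ?e) = \<kappa> * exp (- c * t)"
    proof -
      have "- c * t = - (t / tau) + \<alpha> * \<delta> / tau * t"
        unfolding rate[symmetric] by (simp add: algebra_simps)
      then have "exp (- c * t) = exp (- (t / tau)) * ?e" by (simp only: exp_add)
      then show ?thesis by simp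
    qed
    ultimately show ?thesis by (simp only:)
  qed
  ultimately show ?thesis unfolding c_def by blast
qed

theorem theorem3:
  fixes y :: "real^'m" and \<Phi> :: "real^'n^'m"
    and lam tau :: real
    and f C :: "real \<Rightarrow> real"
    and astar :: "real^'n"
    and \<alpha> \<delta> :: "(real \<Rightarrow> real^'n) \<Rightarrow> real"
  assumes unit_columns: "\<And>n. norm (column n \<Phi>) = 1"
    and pos: "lam > 0" "tau > 0"
    and act: "activation lam f"
    and cost: "cost_function lam f C"
    and minimizer: "objective_minimizer lam f C \<Phi> y astar"
    and alpha: "\<And>u. lca_trajectory tau lam f \<Phi> y u \<Longrightarrow> alpha_constant lam f u (\<alpha> u)"
    and delta: "\<And>u. lca_trajectory tau lam f \<Phi> y u \<Longrightarrow>
                  delta_constant lam \<Phi> (active_set astar) u (\<delta> u)"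
    and small: "\<And>u. lca_trajectory tau lam f \<Phi> y u \<Longrightarrow> \<alpha> u * \<delta> u < 1"
  shows "\<exists>ustar. lca_equilibrium lam f \<Phi> y ustar \<and>
           (\<forall>v. lca_equilibrium lam f \<Phi> y v \<longrightarrow> v = ustar) \<and>
           globally_exp_convergent (lca_trajectory tau lam f \<Phi> y) ustar
             (\<lambda>u. (1 - \<alpha> u * \<delta> u) / tau)"
proof -
  define us where "us = astar + transpose \<Phi> *v (y - \<Phi> *v astar)"
  have out: "thr_vec lam f us = astar"
    unfolding us_def by (rule thr_vec_minimizer[OF unit_columns pos(1) act cost minimizer])
  then have eq: "lca_equilibrium lam f \<Phi> y us"
    unfolding us_def by (rule lca_equilibrium_of_output)
  obtain D where D: "0 \<le> D" "\<And>x. \<bar>gram_form \<Phi> x x\<bar> \<le> D * (norm x)\<^sup>2"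
    "\<And>d. (\<And>x. \<bar>gram_form \<Phi> x x\<bar> \<le> d * (norm x)\<^sup>2) \<Longrightarrow> D \<le> d"
    using gram_form_extremal[of \<Phi>] by blast
  \<comment> \<open>A trajectory started at \<open>(v, \<dots>, v)\<close> has all nodes active at time 0, which turns the
    hypotheses about single trajectories into a global bound.\<close>
  have contr: "D * deriv f v < 1" if v: "lam < v" for v
  proof -
    obtain u where u: "lca_trajectory tau lam f \<Phi> y u" "u 0 = (\<chi> n. v)"
      using lca_trajectory_exists[OF pos act] by blast
    have "isometry_bound lam \<Phi> (active_set astar) u (\<delta> u)" "0 < \<delta> u"
      using delta[OF u(1)] by (auto simp: delta_constant_def)
    moreover have "active_nodes lam (u 0) = UNIV" using u(2) v by (auto simp: active_nodes_def)
    ultimately have "D \<le> \<delta> u"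
      using isometry_bound_gram[of lam \<Phi> "active_set astar" u "\<delta> u" 0] by (intro D(3)) auto
    moreover have "deriv f v \<le> \<alpha> u"
    proof -
      \<comment> \<open>Any index would do, as all coordinates start at \<open>v\<close>.\<close>
      have "u 0 $ undefined = v" using u(2) by simp
      then show ?thesis using alpha[OF u(1)] v unfolding alpha_constant_def
        by (smt (verit))
    qed
    ultimately have "D * deriv f v \<le> \<delta> u * \<alpha> u"
      using act_deriv_pos[OF pos(1) act v] D(1) by (intro mult_mono) auto
    then show ?thesis using small[OF u(1)] by (simp add: mult.commute)
  qed
  have lim: "(u \<longlongrightarrow> us) at_top" if "lca_trajectory tau lam f \<Phi> y u" for u
    by (rule lca_tendsto_equilibrium[OF pos act D(1,2) contr eq that])
  \<comment> \<open>An equilibrium is a constant trajectory, so its convergence to \<open>us\<close>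
    forces equality.\<close>
  have "v = us" if "lca_equilibrium lam f \<Phi> y v" for v
    using lim[OF equilibrium_trajectory[OF that]] by (simp add: tendsto_const_iff)
  moreover have "globally_exp_convergent (lca_trajectory tau lam f \<Phi> y) us (\<lambda>u. (1 - \<alpha> u * \<delta> u) / tau)"
    unfolding globally_exp_convergent_def
  proof (intro allI impI conjI)
    fix u assume u: "lca_trajectory tau lam f \<Phi> y u"
    show "0 < (1 - \<alpha> u * \<delta> u) / tau" using small[OF u] pos by simp
    show "\<exists>\<kappa>>0. \<forall>t\<ge>0. norm (u t - us) \<le> \<kappa> * exp (- ((1 - \<alpha> u * \<delta> u) / tau) * t)"
      using delta[OF u] out
      by (intro lca_exp_convergence[OF pos act eq u lim[OF u] alpha[OF u]]) (auto simp: delta_constant_def)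
  qed
  ultimately show ?thesis using eq by blast
qed

end
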